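(* Let $X$ be a planar polynomial vector field whose Newton polytope $\mathcal{P}_X$ is favorable, and let $(\alpha,\beta)$ be the weight vector determined by the line $\{\alpha m+\beta n=\delta\}$ containing the upper main segment $\gamma_h$ of $\mathcal{P}_X$. After Poincaré--Lyapunov compactification in the positive $x$-direction with weight $(\alpha,\beta)$, the lower boundary of the Newton polytope $\mathcal{P}_{\overline{X}^{+}_{x}}$ is the image of the right upper part of $\mathcal{P}^{U}_{X}$.
   Context: **Newton polytope.** Every planar polynomial vector field is written uniquely as a finite sum $X(x,y)=\sum_{m,n} x^{m}y^{n}\big(a_{m,n}x\frac{\partial}{\partial x}+b_{m,n}y\frac{\partial}{\partial y}\big)$ with $m,n\in\mathbb{Z}$, $a_{m,n},b_{m,n}\in\mathbb{R}$, where $a_{m,n}=0$ if $m<-1$ or $n\le -1$, and $b_{m,n}=0$ if $m\le -1$ or $n<-1$. The support is $\mathcal{S}_X=\{(m,n)\in\mathbb{Z}^2: a_{m,n}^2+b_{m,n}^2\neq 0\}$ and the Newton polytope $\mathcal{P}_X$ is the convex hull of $\mathcal{S}_X$ (same definition for a vector field in variables $(u,v)$, using the exponents of $u$ and $v$ in this order). Let $\mathcal{P}_+$ be the convex hull of $\mathcal{S}_X+(\mathbb{R}_{\ge 0})^2$. If $\mathcal{P}_X$ has non-empty interior, the lower boundary $\mathcal{P}^L_X$ is the union of the compact segments of $\partial\mathcal{P}_+$ and the upper boundary $\mathcal{P}^U_X$ is the closure of $\partial\mathcal{P}_X\setminus\partial\mathcal{P}_+$; if the interior is empty, $\mathcal{P}_X=\mathcal{P}^L_X=\mathcal{P}^U_X$.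 $\mathcal{P}_X$ is favorable if $\mathcal{P}^U_X$ has at least one segment with negative slope. **Vertices and segments.** The vertices of $\mathcal{P}_X$ are enumerated counterclockwise $p_0,\dots,p_k$, with $p_0$ the first point of the support in lexicographical order; $\gamma_l$ is the edge joining $p_{l-1}$ to $p_l$ and $\gamma_{k+1}$ the edge joining $p_k$ to $p_0$. The upper main vertex $p_h=(m_h,n_h)$ is the last point of $\mathcal{S}_X$ in lexicographical order such that $n_h\ge n$ for all $(m,n)\in\mathcal{P}_X$; the upper main segment $\gamma_h$ is the edge that ends at $p_h$ in the counterclockwise enumeration. When $\mathcal{P}_X$ is favorable, $\gamma_h$ lies in a line $\{\alpha m+\beta n=\delta\}$ with $\alpha,\beta$ positive integers, and $\delta$ is the maximum of $\alpha m+\beta n$ on $\mathcal{S}_X$. Enumerating the segments of $\mathcal{P}^U_X$ counterclockwise as $\gamma_1^U,\dots,\gamma_{l-1}^U,\gamma_h,\gamma_{l+1}^U,\dots,\gamma_k^U$, the right upper part of $\mathcal{P}^U_X$ is the union of $\gamma_1^U,\dots,\gamma_{l-1}^U$ and the left upper part is the union of $\gamma_{l+1}^U,\dots,\gamma_k^U$. **Compactification in the positive $x$-direction.** With weight $(\alpha,\beta)$, it is the vector field obtained by the change of variables $x=v^{-\alpha}$, $y=uv^{-\beta}$ followed by multiplication by $v^{\delta}$: $$\overline{X}^{+}_{x}(u,v)=\sum_{(m,n)\in\mathcal{S}_X}v^{\delta-(\alpha m+\beta n)}u^{n}\Big(\big(b_{m,n}-\tfrac{\beta}{\alpha}a_{m,n}\big)u\frac{\partial}{\partial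 u}-\frac{1}{\alpha}a_{m,n}v\frac{\partial}{\partial v}\Big).$$ The "image" is under the induced map of exponents $(m,n)\mapsto(n,\delta-\alpha m-\beta n)$. *)

theory Defs
  imports "HOL-Analysis.Analysis" "HOL-Computational_Algebra.Polynomial"
begin

section \<open>Planar polynomial vector fields\<close>

text \<open>A vector field \<open>F \<partial>/\<partial>x + G \<partial>/\<partial>y\<close> is the pair \<open>(F, G)\<close>; a bivariate polynomial has \<open>y\<close> as its
  outer and \<open>x\<close> as its inner variable, i.e. \<open>c x\<^sup>i y\<^sup>j\<close> is \<open>monom (monom c i) j\<close>.\<close>

type_synonym vector_field = "real poly poly \<times> real poly poly"

text \<open>\<open>X\<close> is the sum of the fields \<open>x\<^sup>m y\<^sup>n (a\<^sub>m\<^sub>n x \<partial>/\<partial>x + b\<^sub>m\<^sub>n y \<partial>/\<partial>y)\<close>, so \<open>a\<^sub>m\<^sub>n\<close> is the coefficient of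
  \<open>x\<^sup>m\<^sup>+\<^sup>1 y\<^sup>n\<close> in the first component and \<open>b\<^sub>m\<^sub>n\<close> that of \<open>x\<^sup>m y\<^sup>n\<^sup>+\<^sup>1\<close> in the second; see
  \<open>vector_field_expansion\<close> below.\<close>

definition coeff_a :: "vector_field \<Rightarrow> int \<Rightarrow> int \<Rightarrow> real" where
  "coeff_a X m n =
     (if m < -1 \<or> n \<le> -1 then 0 else coeff (coeff (fst X) (nat n)) (nat (m + 1)))"

definition coeff_b :: "vector_field \<Rightarrow> int \<Rightarrow> int \<Rightarrow> real" where
  "coeff_b X m n =
     (if m \<le> -1 \<or> n < -1 then 0 else coeff (coeff (snd X) (nat (n + 1))) (nat m))"

definition support :: "vector_field \<Rightarrow> (int \<times> int) set" where
  "support X = {(m, n). (coeff_a X m n)\<^sup>2 + (coeff_b X m n)\<^sup>2 \<noteq> 0}"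

text \<open>\<open>x\<^sup>m y\<^sup>n (a x \<partial>/\<partial>x + b y \<partial>/\<partial>y)\<close>.  This is only meaningful if no negative exponent remains, that is,
  if \<open>a = 0\<close> or \<open>m \<ge> -1, n \<ge> 0\<close>, and \<open>b = 0\<close> or \<open>m \<ge> 0, n \<ge> -1\<close>.\<close>

definition monomial_field :: "int \<Rightarrow> int \<Rightarrow> real \<Rightarrow> real \<Rightarrow> vector_field" where
  "monomial_field m n a b =
     (monom (monom a (nat (m + 1))) (nat n), monom (monom b (nat m)) (nat (n + 1)))"

lemma finite_support: "finite (support X)"
proof -
  define A :: "real poly poly \<Rightarrow> (nat \<times> nat) set"
    where "A = (\<lambda>p. SIGMA j:{..degree p}. {..degree (coeff p j)})"
  have fin: "finite (A p)" for p
    unfolding A_def by auto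
  have A: "(j, i) \<in> A p" if "coeff (coeff p j) i \<noteq> 0" for p i j
  proof -
    have "coeff p j \<noteq> 0"
      using that by auto
    then show ?thesis
      using that by (auto simp: A_def le_degree)
  qed
  have "support X \<subseteq> (\<lambda>(j, i). (int i - 1, int j)) ` A (fst X) \<union>
                     (\<lambda>(j, i). (int i, int j - 1)) ` A (snd X)"
  proof
    fix p assume "p \<in> support X"
    then obtain m n where p: "p = (m, n)" and *: "coeff_a X m n \<noteq> 0 \<or> coeff_b X m n \<noteq> 0"
      by (auto simp: support_def)
    from * show "p \<in> (\<lambda>(j, i). (int i - 1, int j)) ` A (fst X) \<union>
                     (\<lambda>(j, i). (int i, int j - 1)) ` A (snd X)"
    proof
      assume "coeff_a X m n \<noteq> 0"
      then have "(nat n, nat (m + 1)) \<in> A (fst X)" "m \<ge> -1" "n \<ge> 0"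
        by (auto simp: coeff_a_def split: if_splits intro!: A)
      then show ?thesis
        unfolding p by (intro UnI1 image_eqI[where x = "(nat n, nat (m + 1))"]) auto
    next
      assume "coeff_b X m n \<noteq> 0"
      then have "(nat (n + 1), nat m) \<in> A (snd X)" "m \<ge> 0" "n \<ge> -1"
        by (auto simp: coeff_b_def split: if_splits intro!: A)
      then show ?thesis
        unfolding p by (intro UnI2 image_eqI[where x = "(nat (n + 1), nat m)"]) auto
    qed
  qed
  then show ?thesis
    by (rule finite_subset) (use fin in auto)
qed

lemma vector_field_expansion:
  "X = (\<Sum>(m, n)\<in>support X. monomial_field m n (coeff_a X m n) (coeff_b X m n))"
proof -
  let ?S = "\<Sum>p\<in>support X. monomial_field (fst p) (snd p)
              (coeff_a X (fst p) (snd p)) (coeff_b X (fst p) (snd p))"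
  have "coeff (coeff (fst ?S) j) i = coeff (coeff (fst X) j) i" for i j
  proof -
    have "coeff (coeff (fst ?S) j) i = (\<Sum>p\<in>support X. if p = (int i - 1, int j)
            then coeff_a X (int i - 1) (int j) else 0)"
      unfolding fst_sum coeff_sum
      by (intro sum.cong refl) (auto simp: monomial_field_def coeff_a_def)
    also have "\<dots> = coeff_a X (int i - 1) (int j)"
      by (auto simp: finite_support) (auto simp: support_def)
    finally show ?thesis
      by (simp add: coeff_a_def)
  qed
  moreover have "coeff (coeff (snd ?S) j) i = coeff (coeff (snd X) j) i" for i j
  proof -
    have "coeff (coeff (snd ?S) j) i = (\<Sum>p\<in>support X. if p = (int i, int j - 1)
            then coeff_b X (int i) (int j - 1) else 0)"
      unfolding snd_sum coeff_sum
      by (intro sum.cong refl) (auto simp: monomial_field_def coeff_b_def)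
    also have "\<dots> = coeff_b X (int i) (int j - 1)"
      by (auto simp: finite_support) (auto simp: support_def)
    finally show ?thesis
      by (simp add: coeff_b_def)
  qed
  ultimately have "X = ?S"
    by (intro prod_eqI poly_eqI) simp_all
  then show ?thesis
    by (simp add: case_prod_unfold)
qed


section \<open>Newton polytope\<close>

definition real_point :: "int \<times> int \<Rightarrow> real \<times> real" where
  "real_point p = (of_int (fst p), of_int (snd p))"

definition newton_polytope :: "vector_field \<Rightarrow> (real \<times> real) set" where
  "newton_polytope X = convex hull (real_point ` support X)"

definition newton_polyhedron :: "vector_field \<Rightarrow> (real \<times> real) set" where
  "newton_polyhedron X =
     convex hull {p + q | p q. p \<in> real_point ` support X \<and> 0 \<le> fst q \<and> 0 \<le> snd q}"

definition lower_boundary :: "vector_field \<Rightarrow> (real \<times> real) set" where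
  "lower_boundary X =
     (if interior (newton_polytope X) \<noteq> {}
      then \<Union> {e. e edge_of newton_polyhedron X \<and> compact e}
      else newton_polytope X)"

definition upper_boundary :: "vector_field \<Rightarrow> (real \<times> real) set" where
  "upper_boundary X =
     (if interior (newton_polytope X) \<noteq> {}
      then closure (frontier (newton_polytope X) - frontier (newton_polyhedron X))
      else newton_polytope X)"

definition negative_slope :: "(real \<times> real) set \<Rightarrow> bool" where
  "negative_slope e \<longleftrightarrow>
     (\<exists>p q. e = closed_segment p q \<and> fst p < fst q \<and> (snd q - snd p) / (fst q - fst p) < 0)"

definition favorable :: "vector_field \<Rightarrow> bool" where
  "favorable X \<longleftrightarrow>
     (\<exists>e. e edge_of newton_polytope X \<and> e \<subseteq> upper_boundary X \<and> negative_slope e)"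


section \<open>Vertices and segments\<close>

definition lex_le :: "real \<times> real \<Rightarrow> real \<times> real \<Rightarrow> bool" where
  "lex_le p q \<longleftrightarrow> fst p < fst q \<or> fst p = fst q \<and> snd p \<le> snd q"

definition orientation :: "real \<times> real \<Rightarrow> real \<times> real \<Rightarrow> real \<times> real \<Rightarrow> real" where
  "orientation p q r =
     (fst q - fst p) * (snd r - snd p) - (snd q - snd p) * (fst r - fst p)"

text \<open>The vertices in counterclockwise order, starting at the lexicographically first point of the
  support.  For points in convex position, counterclockwise order means that any three of them,
  taken in list order, form a positively oriented triangle.\<close>

definition vertex_enumeration :: "vector_field \<Rightarrow> (real \<times> real) list \<Rightarrow> bool" where
  "vertex_enumeration X ps \<longleftrightarrow>
     distinct ps \<and>
     set ps = {p. p extreme_point_of newton_polytope X} \<and>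
     (ps \<noteq> [] \<longrightarrow> (\<forall>q\<in>real_point ` support X. lex_le (ps ! 0) q)) \<and>
     (\<forall>i j k. i < j \<and> j < k \<and> k < length ps \<longrightarrow> orientation (ps ! i) (ps ! j) (ps ! k) > 0)"

text \<open>With \<open>k + 1\<close> vertices \<open>p\<^sub>0, \<dots>, p\<^sub>k\<close> there are \<open>k + 1\<close> edges: \<open>segment ps i\<close> runs from \<open>p\<^sub>i\<close> to
  \<open>p\<^sub>i\<^sub>+\<^sub>1\<close> for \<open>i < k\<close>, and \<open>segment ps k\<close> closes the polygon from \<open>p\<^sub>k\<close> to \<open>p\<^sub>0\<close>.  A polytope that is
  a line segment thus has two edges, which coincide as sets but run in opposite directions.\<close>

definition segment :: "(real \<times> real) list \<Rightarrow> nat \<Rightarrow> (real \<times> real) set" where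
  "segment ps i = closed_segment (ps ! i) (ps ! (Suc i mod length ps))"

definition upper_main_vertex :: "vector_field \<Rightarrow> real \<times> real \<Rightarrow> bool" where
  "upper_main_vertex X p \<longleftrightarrow>
     (let T = {q \<in> real_point ` support X. \<forall>r\<in>newton_polytope X. snd r \<le> snd q}
      in p \<in> T \<and> (\<forall>q\<in>T. lex_le q p))"

text \<open>\<open>segment ps h\<close> is the edge that ends at the upper main vertex.\<close>

definition upper_main_segment :: "vector_field \<Rightarrow> (real \<times> real) list \<Rightarrow> nat \<Rightarrow> bool" where
  "upper_main_segment X ps h \<longleftrightarrow>
     h < length ps \<and> upper_main_vertex X (ps ! (Suc h mod length ps))"

text \<open>The first vertex is never an inner point of the arc formed by the upper boundary, so listing
  the segments of the upper boundary by increasing index lists them counterclockwise.\<close>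

definition right_upper_part ::
    "vector_field \<Rightarrow> (real \<times> real) list \<Rightarrow> nat \<Rightarrow> (real \<times> real) set" where
  "right_upper_part X ps h = \<Union> {segment ps i | i. i < h \<and> segment ps i \<subseteq> upper_boundary X}"


section \<open>Compactification in the positive x-direction\<close>

definition compactification_x :: "int \<Rightarrow> int \<Rightarrow> int \<Rightarrow> vector_field \<Rightarrow> vector_field" where
  "compactification_x \<alpha> \<beta> \<delta> X =
     (\<Sum>(m, n)\<in>support X. monomial_field n (\<delta> - (\<alpha> * m + \<beta> * n))
        (coeff_b X m n - of_int \<beta> / of_int \<alpha> * coeff_a X m n)
        (- (1 / of_int \<alpha>) * coeff_a X m n))"

definition exponent_map :: "int \<Rightarrow> int \<Rightarrow> int \<Rightarrow> real \<times> real \<Rightarrow> real \<times> real" where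
  "exponent_map \<alpha> \<beta> \<delta> = (\<lambda>(m, n). (n, of_int \<delta> - of_int \<alpha> * m - of_int \<beta> * n))"

definition eval_field :: "vector_field \<Rightarrow> real \<Rightarrow> real \<Rightarrow> real \<times> real" where
  "eval_field X x y = (poly (poly (fst X) [:y:]) x, poly (poly (snd X) [:y:]) x)"

lemma eval_field_sum: "eval_field (sum f A) x y = (\<Sum>p\<in>A. eval_field (f p) x y)"
  by (rule prod_eqI) (simp_all add: eval_field_def fst_sum snd_sum poly_sum)

lemma eval_monomial_field:
  "eval_field (monomial_field m n a b) x y =
     (a * x ^ nat (m + 1) * y ^ nat n, b * x ^ nat m * y ^ nat (n + 1))"
  by (simp add: eval_field_def monomial_field_def poly_monom)

text \<open>The sum above is the transform of \<open>v\<^sup>\<delta> X\<close> under \<open>x = v powi -\<alpha>\<close>, \<open>y = u * v powi -\<beta>\<close>: the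
  derivative of this change of variables maps it to \<open>v\<^sup>\<delta> X\<close>.\<close>

lemma compactification_x_change_of_variables:
  fixes u v :: real
  assumes "\<alpha> > 0" "v > 0" and "\<And>m n. (m, n) \<in> support X \<Longrightarrow> \<alpha> * m + \<beta> * n \<le> \<delta>"
    and "eval_field (compactification_x \<alpha> \<beta> \<delta> X) u v = (U, V)"
  shows "(- of_int \<alpha> * v powi (-\<alpha> - 1) * V,
          v powi (-\<beta>) * U - of_int \<beta> * u * v powi (-\<beta> - 1) * V) =
         v powi \<delta> *\<^sub>R eval_field X (v powi (-\<alpha>)) (u * v powi (-\<beta>))"
proof -
  let ?L = "\<lambda>w::real \<times> real. (- of_int \<alpha> * v powi (-\<alpha> - 1) * snd w,
    v powi (-\<beta>) * fst w - of_int \<beta> * u * v powi (-\<beta> - 1) * snd w)"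
  define x where "x = v powi (-\<alpha>)"
  define y where "y = u * v powi (-\<beta>)"
  define T where "T = (\<lambda>p. monomial_field (snd p) (\<delta> - (\<alpha> * fst p + \<beta> * snd p))
    (coeff_b X (fst p) (snd p) - of_int \<beta> / of_int \<alpha> * coeff_a X (fst p) (snd p))
    (- (1 / of_int \<alpha>) * coeff_a X (fst p) (snd p)))"
  define M where "M = (\<lambda>p. monomial_field (fst p) (snd p)
    (coeff_a X (fst p) (snd p)) (coeff_b X (fst p) (snd p)))"
  have v: "v \<noteq> 0"
    using assms by simp
  have nat_pow: "z ^ nat k = z powi k" if "k \<ge> 0" for z :: real and k
    using that by (simp add: power_int_def)
  have "?L (eval_field (T p) u v) = v powi \<delta> *\<^sub>R eval_field (M p) x y"
    if "p \<in> support X" for p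
  proof -
    obtain m n where p: "p = (m, n)"
      by force
    define a where "a = coeff_a X m n"
    define b where "b = coeff_b X m n"
    define e where "e = \<delta> - (\<alpha> * m + \<beta> * n)"
    have e: "e \<ge> 0"
      using assms(3)[of m n] that p by (simp add: e_def)
    have ev: "v ^ nat e = v powi e" "v ^ nat (e + 1) = v powi (e + 1)"
      using e by (auto intro!: nat_pow)
    have y: "y ^ k = u ^ k * v powi (-\<beta> * int k)" for k
      by (simp only: y_def power_mult_distrib power_int_mult power_int_of_nat)
    have x: "x ^ k = v powi (-\<alpha> * int k)" for k
      by (simp only: x_def power_int_mult power_int_of_nat)
    have 1: "v powi (-\<alpha> - 1) * a * u ^ nat n * v ^ nat (e + 1) =
             v powi \<delta> * a * x ^ nat (m + 1) * y ^ nat n"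
    proof (cases "a = 0")
      case False
      then have mn: "m \<ge> -1" "n \<ge> 0"
        by (auto simp: a_def coeff_a_def split: if_splits)
      have "v powi (-\<alpha> - 1) * v powi (e + 1) = v powi (-\<alpha> - 1 + (e + 1))"
        using v by (intro power_int_add[symmetric]) auto
      also have "-\<alpha> - 1 + (e + 1) = \<delta> + (-\<alpha> * (m + 1) + -\<beta> * n)"
        by (simp add: e_def algebra_simps)
      also have "v powi \<dots> = v powi \<delta> * (v powi (-\<alpha> * (m + 1)) * v powi (-\<beta> * n))"
        using v by (simp only: power_int_add simp_thms)
      finally show ?thesis
        using mn by (simp add: x y ev)
    qed simp
    have 2: "v powi (-\<beta>) * b * u ^ nat (n + 1) * v ^ nat e =
             v powi \<delta> * b * x ^ nat m * y ^ nat (n + 1)"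
    proof (cases "b = 0")
      case False
      then have mn: "m \<ge> 0" "n \<ge> -1"
        by (auto simp: b_def coeff_b_def split: if_splits)
      have "v powi (-\<beta>) * v powi e = v powi (-\<beta> + e)"
        using v by (intro power_int_add[symmetric]) auto
      also have "-\<beta> + e = \<delta> + (-\<alpha> * m + -\<beta> * (n + 1))"
        by (simp add: e_def algebra_simps)
      also have "v powi \<dots> = v powi \<delta> * (v powi (-\<alpha> * m) * v powi (-\<beta> * (n + 1)))"
        using v by (simp only: power_int_add simp_thms)
      finally show ?thesis
        using mn by (simp add: x y ev)
    qed simp
    have 3: "v powi (-\<beta>) * a * u ^ nat (n + 1) * v ^ nat e =
             u * v powi (-\<beta> - 1) * a * u ^ nat n * v ^ nat (e + 1)"
    proof (cases "a = 0")
      case False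
      then have n: "n \<ge> 0"
        by (auto simp: a_def coeff_a_def split: if_splits)
      have "v powi (-\<beta>) * v powi e = v powi (-\<beta> - 1) * v powi (e + 1)"
        using v by (simp flip: power_int_add)
      then show ?thesis
        using n by (simp add: ev nat_add_distrib)
    qed simp
    have \<alpha>: "real_of_int \<alpha> \<noteq> 0"
      using assms(1) by simp
    have "?L (eval_field (T p) u v) =
      (v powi (-\<alpha> - 1) * a * u ^ nat n * v ^ nat (e + 1),
       v powi (-\<beta>) * b * u ^ nat (n + 1) * v ^ nat e
       - of_int \<beta> / of_int \<alpha> * (v powi (-\<beta>) * a * u ^ nat (n + 1) * v ^ nat e
       - u * v powi (-\<beta> - 1) * a * u ^ nat n * v ^ nat (e + 1)))"
      using \<alpha> by (simp add: T_def p eval_monomial_field flip: a_def b_def e_def)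
        (simp add: field_simps)
    then show ?thesis
      unfolding 3 1 2
      by (simp add: M_def p eval_monomial_field flip: a_def b_def)
  qed
  then have "(\<Sum>p\<in>support X. ?L (eval_field (T p) u v)) =
             v powi \<delta> *\<^sub>R (\<Sum>p\<in>support X. eval_field (M p) x y)"
    by (simp add: scaleR_right.sum)
  also have "(\<Sum>p\<in>support X. ?L (eval_field (T p) u v)) =
             ?L (\<Sum>p\<in>support X. eval_field (T p) u v)"
    by (rule prod_eqI) (simp_all add: fst_sum snd_sum sum_distrib_left sum_subtractf)
  also have "(\<Sum>p\<in>support X. eval_field (M p) x y) = eval_field X x y"
    by (subst (2) vector_field_expansion) (simp add: M_def eval_field_sum case_prod_unfold)
  also have "(\<Sum>p\<in>support X. eval_field (T p) u v) = (U, V)"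
    using assms(4) by (simp add: compactification_x_def T_def eval_field_sum case_prod_unfold)
  finally show ?thesis
    by (simp add: x_def y_def)
qed

end

(* Write nu = (nu_1, nu_2) for the outer normal of an edge of the polygon.  An edge lies in the upper
   boundary iff nu does not lie in the closed third quadrant, and the compact edges of a polygon plus
   the first quadrant are those with nu in the open third quadrant.  The map of exponents is affine
   and preserves orientation; it turns nu into (alpha nu_2 - beta nu_1, -nu_1).  So the lower boundary
   of the image comes from the edges whose normal lies strictly between (0, -1) and (alpha, beta).
   As (alpha, beta) is normal to the upper main segment, convexity shows that these are exactly the
   edges of the upper boundary that precede it. *)

theory Submission
  imports Defs
begin

text \<open>Two obstacles shape the proof. First, "precede" is a comparison of indices in a list
  that cuts the cycle of edges at the lexicographically first vertex, whereas the compactification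
  selects a sector of normals. Angles are never compared. Instead, the identity (v x w) u + (w x u)
  v + (u x v) w = 0 for cross products of plane vectors is evaluated under a coordinate or under the
  weight; the signs of the cross products are orientations of triples of vertices. Second, the two
  boundaries are defined by frontiers and faces, not by indices. Supporting functionals bridge this
  gap: on the polygon such a functional is maximal at one vertex or along one edge, and the added
  quadrant forces its coordinates to be nonpositive, and negative if the face of the sum is compact.
  Normals are transformed by the cofactor matrix of the linear part of the exponent map, whose
  determinant is \<alpha>. A polytope that is a segment has two coinciding edges with opposite
  directions and is treated on its own.\<close>

section \<open>Convex polygons\<close>

text \<open>Testing all increasing triples, not just consecutive ones, excludes closed paths that
  wind around several times. The length bound excludes segments.\<close>

definition ccw_polygon :: "(real \<times> real) list \<Rightarrow> bool" where
  "ccw_polygon ps \<longleftrightarrow> 3 \<le> length ps \<and>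
     (\<forall>i j k. i < j \<and> j < k \<and> k < length ps \<longrightarrow> orientation (ps ! i) (ps ! j) (ps ! k) > 0)"

text \<open>The edge vector turned clockwise by a right angle, hence pointing away from a polygon on
  the left of its edges. It is left unnormalised, so its coordinates are differences of vertex
  coordinates.\<close>

definition outer_normal :: "(real \<times> real) list \<Rightarrow> nat \<Rightarrow> real \<times> real" where
  "outer_normal ps i =
     (snd (ps ! (Suc i mod length ps)) - snd (ps ! i), fst (ps ! i) - fst (ps ! (Suc i mod length ps)))"

lemma orientation_rotate: "orientation q r p = orientation p q r"
  by (simp add: orientation_def algebra_simps)

lemma orientation_swap: "orientation p r q = - orientation p q r"
  by (simp add: orientation_def algebra_simps)

text \<open>Orientation is the signed distance to the edge times its length; this translates between
  orientations and values of the normal functional.\<close>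

lemma inner_outer_normal:
  "outer_normal ps i \<bullet> r = outer_normal ps i \<bullet> (ps ! i) -
     orientation (ps ! i) (ps ! (Suc i mod length ps)) r"
  by (simp add: outer_normal_def orientation_def inner_prod_def algebra_simps)

lemma orientation_eq_0:
  assumes "c \<noteq> 0" "c \<bullet> q = c \<bullet> p" "c \<bullet> r = c \<bullet> p"
  shows "orientation p q r = 0"
proof -
  let ?o = "orientation p q r"
  have eq: "fst c * (fst q - fst p) + snd c * (snd q - snd p) = 0"
    "fst c * (fst r - fst p) + snd c * (snd r - snd p) = 0"
    using assms by (simp_all add: inner_prod_def algebra_simps)
  \<comment> \<open>Both differences are orthogonal to \<open>c\<close>, hence parallel. Multiplying
    by the coordinates of \<open>c\<close> avoids asking which of them is nonzero.\<close>
  have "fst c * ?o = 0" "snd c * ?o = 0"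
    using eq unfolding orientation_def by algebra+
  then show ?thesis
    using assms(1) by (auto simp: prod_eq_iff)
qed

text \<open>The vectors orthogonal to \<open>q - p\<close> form a line, spanned by the rotated
  difference; \<open>t\<close> is the projection coefficient of \<open>c\<close> onto it.\<close>

lemma functional_proportional:
  assumes "p \<noteq> q" "c \<bullet> q = c \<bullet> p"
  obtains t where "\<And>r. c \<bullet> r = c \<bullet> p - t * orientation p q r"
    "c = t *\<^sub>R (snd q - snd p, fst p - fst q)"
proof -
  let ?dx = "fst q - fst p" and ?dy = "snd q - snd p"
  have n: "?dx\<^sup>2 + ?dy\<^sup>2 \<noteq> 0"
    using assms(1) by (auto simp: prod_eq_iff)
  have eq: "fst c * ?dx + snd c * ?dy = 0"
    using assms by (simp_all add: inner_prod_def algebra_simps)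
  define t where "t = (fst c * ?dy - snd c * ?dx) / (?dx\<^sup>2 + ?dy\<^sup>2)"
  have t: "t * (?dx\<^sup>2 + ?dy\<^sup>2) = fst c * ?dy - snd c * ?dx"
    using n by (simp add: t_def)
  have "(fst c - t * ?dy) * (?dx\<^sup>2 + ?dy\<^sup>2) = 0" "(snd c + t * ?dx) * (?dx\<^sup>2 + ?dy\<^sup>2) = 0"
    using t eq by algebra+
  then have c: "fst c = t * ?dy" "snd c = - t * ?dx"
    using n by auto
  show ?thesis
  proof
    show "c = t *\<^sub>R (snd q - snd p, fst p - fst q)"
      using c by (simp add: prod_eq_iff algebra_simps)
    show "c \<bullet> r = c \<bullet> p - t * orientation p q r" for r
      by (simp add: inner_prod_def c orientation_def algebra_simps)
  qed
qed

text \<open>Orientation is invariant under cyclic rotation, so the indices can be put in increasing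
  order; for the closing edge the increasing triple starts with 0.\<close>

lemma ccw_polygon_edge:
  assumes "ccw_polygon ps" "i < length ps" "j < length ps" "j \<noteq> i" "j \<noteq> Suc i mod length ps"
  shows "orientation (ps ! i) (ps ! (Suc i mod length ps)) (ps ! j) > 0"
proof (cases "Suc i < length ps")
  case True
  then consider "j < i" | "Suc i < j"
    using assms by force
  then show ?thesis
  proof cases
    case 1
    then have "orientation (ps ! j) (ps ! i) (ps ! Suc i) > 0"
      using assms True unfolding ccw_polygon_def by blast
    then show ?thesis
      using True orientation_rotate[of "ps ! i" "ps ! Suc i" "ps ! j"] by simp
  next
    case 2
    then have "orientation (ps ! i) (ps ! Suc i) (ps ! j) > 0"
      using assms unfolding ccw_polygon_def by blast
    then show ?thesis
      using True by simp
  qed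
next
  case False
  then have i: "Suc i = length ps"
    using assms by simp
  then have "0 < j" "j < i"
    using assms by auto
  then have "orientation (ps ! 0) (ps ! j) (ps ! i) > 0"
    using assms unfolding ccw_polygon_def by blast
  then show ?thesis
    using i orientation_rotate[of "ps ! 0" "ps ! j" "ps ! i"] by simp
qed

lemma ccw_polygon_edge_le:
  assumes "ccw_polygon ps" "i < length ps" "x \<in> convex hull (set ps)"
  shows "outer_normal ps i \<bullet> x \<le> outer_normal ps i \<bullet> (ps ! i)"
proof -
  have "convex hull (set ps) \<subseteq> {x. outer_normal ps i \<bullet> x \<le> outer_normal ps i \<bullet> (ps ! i)}"
  proof (rule hull_minimal)
    show "set ps \<subseteq> {x. outer_normal ps i \<bullet> x \<le> outer_normal ps i \<bullet> (ps ! i)}"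
    proof
      fix x assume "x \<in> set ps"
      then obtain j where j: "j < length ps" "x = ps ! j"
        by (auto simp: in_set_conv_nth)
      have "orientation (ps ! i) (ps ! (Suc i mod length ps)) x \<ge> 0"
        using ccw_polygon_edge[OF assms(1,2) j(1)] j(2)
        by (cases "j = i \<or> j = Suc i mod length ps") (auto simp: orientation_def)
      then show "x \<in> {x. outer_normal ps i \<bullet> x \<le> outer_normal ps i \<bullet> (ps ! i)}"
        by (subst mem_Collect_eq, subst inner_outer_normal) simp
    qed
  qed (rule convex_halfspace_le)
  then show ?thesis
    using assms by blast
qed

lemma ccw_polygon_third_vertex:
  assumes "ccw_polygon ps" "i < length ps"
  obtains k where "k < length ps" "k \<noteq> i" "k \<noteq> Suc i mod length ps"
    "orientation (ps ! i) (ps ! (Suc i mod length ps)) (ps ! k) > 0"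
proof -
  have "\<not> {..<3} \<subseteq> {i, Suc i mod length ps}"
    using card_mono[of "{i, Suc i mod length ps}" "{..<3}"] card_insert_le_m1[of 2 "{Suc i mod length ps}" i]
    by auto
  then obtain k where "k < 3" "k \<noteq> i" "k \<noteq> Suc i mod length ps"
    by auto
  moreover have "k < length ps"
    using assms(1) \<open>k < 3\<close> by (simp add: ccw_polygon_def)
  ultimately show ?thesis
    using that ccw_polygon_edge[OF assms] by blast
qed

lemma ccw_polygon_edge_proper:
  assumes "ccw_polygon ps" "i < length ps"
  shows "ps ! i \<noteq> ps ! (Suc i mod length ps)"
  using ccw_polygon_third_vertex[OF assms] by (metis orientation_def diff_self mult_zero_left less_irrefl)

lemma interior_ccw_polygon:
  assumes "ccw_polygon ps"
  shows "interior (convex hull (set ps)) \<noteq> {}"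
proof
  assume "interior (convex hull (set ps)) = {}"
  then obtain a b where ab: "a \<noteq> 0" "convex hull (set ps) \<subseteq> {x. a \<bullet> x = b}"
    using empty_interior_subset_hyperplane[OF convex_convex_hull] by metis
  then have "a \<bullet> (ps ! i) = b" if "i < length ps" for i
    using subsetD[OF ab(2) hull_inc[OF nth_mem[OF that]]] by simp
  moreover have "0 < length ps" "1 < length ps" "2 < length ps"
    using assms by (auto simp: ccw_polygon_def)
  ultimately have "orientation (ps ! 0) (ps ! 1) (ps ! 2) = 0"
    by (intro orientation_eq_0[OF ab(1)]) metis+
  moreover have "orientation (ps ! 0) (ps ! 1) (ps ! 2) > 0"
    using assms by (auto simp: ccw_polygon_def)
  ultimately show False
    by simp
qed

section \<open>Faces on which a functional is maximal\<close>

lemma outer_normal_maximal: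
  assumes "ccw_polygon ps" "i < length ps" "c \<noteq> 0"
    and "c \<bullet> (ps ! (Suc i mod length ps)) = c \<bullet> (ps ! i)"
    and "\<And>p. p \<in> set ps \<Longrightarrow> c \<bullet> p \<le> c \<bullet> (ps ! i)"
  obtains t where "t > 0" "c = t *\<^sub>R outer_normal ps i"
proof -
  obtain t where t: "\<And>r. c \<bullet> r = c \<bullet> (ps ! i) - t * orientation (ps ! i) (ps ! (Suc i mod length ps)) r"
    "c = t *\<^sub>R outer_normal ps i"
    using functional_proportional[OF ccw_polygon_edge_proper[OF assms(1,2)] assms(4)]
    unfolding outer_normal_def by metis
  obtain k where k: "k < length ps" "orientation (ps ! i) (ps ! (Suc i mod length ps)) (ps ! k) > 0"
    using ccw_polygon_third_vertex[OF assms(1,2)] .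
  have "0 \<le> t * orientation (ps ! i) (ps ! (Suc i mod length ps)) (ps ! k)"
    using assms(5)[OF nth_mem[OF k(1)]] t(1)[of "ps ! k"] by linarith
  then have "t \<ge> 0"
    using k(2) by (simp add: zero_le_mult_iff)
  moreover have "t \<noteq> 0"
    using t(2) assms(3) by auto
  ultimately have "t > 0"
    by simp
  then show ?thesis
    using that t(2) by blast
qed

text \<open>The set is a face, and a face of the hull of a finite set is the hull of some of its
  points, all of which lie on the hyperplane.\<close>

lemma maximal_face_convex_hull:
  fixes V :: "'a::euclidean_space set"
  assumes "finite V" "\<And>v. v \<in> V \<Longrightarrow> c \<bullet> v \<le> b"
  shows "{x \<in> convex hull V. c \<bullet> x = b} = convex hull {v \<in> V. c \<bullet> v = b}"
proof -
  let ?T = "convex hull V \<inter> {x. c \<bullet> x = b}"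
  have "convex hull V \<subseteq> {x. c \<bullet> x \<le> b}"
    using assms(2) by (intro hull_minimal) (auto simp: convex_halfspace_le)
  then have T: "?T face_of convex hull V"
    by (intro face_of_Int_supporting_hyperplane_le) auto
  then obtain W where W: "W \<subseteq> V" "?T = convex hull W"
    using face_of_convex_hull_subset[OF finite_imp_compact[OF assms(1)]] by metis
  have "W \<subseteq> {v \<in> V. c \<bullet> v = b}"
    using W hull_subset[of W convex] by auto
  then have "?T \<subseteq> convex hull {v \<in> V. c \<bullet> v = b}"
    using W(2) by (simp add: hull_mono)
  moreover have "convex hull {v \<in> V. c \<bullet> v = b} \<subseteq> ?T"
    using T by (intro hull_minimal) (auto simp: hull_inc face_of_imp_convex)
  ultimately show ?thesis
    by blast
qed

text \<open>Vertices with index strictly between \<open>i\<close> and \<open>j\<close> lie strictly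
  on the right of the line through \<open>ps ! i\<close> and \<open>ps ! j\<close>, all others
  strictly on its left. Maximality of \<open>c\<close> on this line leaves one side empty, so the
  two indices are cyclically adjacent.\<close>

lemma ccw_polygon_maximal_vertices:
  assumes "ccw_polygon ps" "c \<noteq> 0" "\<And>p. p \<in> set ps \<Longrightarrow> c \<bullet> p \<le> b"
    and "i < j" "j < length ps" "c \<bullet> (ps ! i) = b" "c \<bullet> (ps ! j) = b"
  obtains l where "l < length ps" "{p \<in> set ps. c \<bullet> p = b} = {ps ! l, ps ! (Suc l mod length ps)}"
proof -
  have ccw: "orientation (ps ! i) (ps ! j) (ps ! k) > 0" if "i < j" "j < k" "k < length ps" for i j k
    using assms(1) that unfolding ccw_polygon_def by blast
  have out: "orientation (ps ! i) (ps ! j) (ps ! k) > 0" if "k < i \<or> j < k" "k < length ps" for k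
    using that ccw[of k i j] ccw[of i j k] assms(4,5) orientation_rotate[of "ps ! i" "ps ! j" "ps ! k"]
    by auto
  have mid: "orientation (ps ! i) (ps ! j) (ps ! k) < 0" if "i < k" "k < j" for k
    using ccw[of i k j] that assms(5) orientation_swap[of "ps ! i" "ps ! j" "ps ! k"] by linarith
  have "k = i \<or> k = j" if "k < length ps" "c \<bullet> (ps ! k) = b" for k
  proof -
    have "orientation (ps ! i) (ps ! j) (ps ! k) = 0"
      using orientation_eq_0[OF assms(2)] assms(6,7) that by simp
    then show ?thesis
      using out[of k] mid[of k] that(1) by force
  qed
  then have "{p \<in> set ps. c \<bullet> p = b} \<subseteq> {ps ! i, ps ! j}"
    unfolding in_set_conv_nth by blast
  moreover have "{ps ! i, ps ! j} \<subseteq> {p \<in> set ps. c \<bullet> p = b}"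
    using assms(4-7) by simp
  ultimately have two: "{p \<in> set ps. c \<bullet> p = b} = {ps ! i, ps ! j}"
    by (rule subset_antisym)
  have "j = Suc i \<or> i = 0 \<and> Suc j = length ps"
  proof (rule ccontr)
    assume *: "\<not> ?thesis"
    have "\<exists>l<length ps. l < i \<or> j < l"
    proof (cases "i = 0")
      case True
      then show ?thesis
        using * assms(5) by (intro exI[of _ "Suc j"]) auto
    qed (use assms(4,5) in \<open>auto intro: exI[of _ 0]\<close>)
    then obtain l where l: "l < length ps" "l < i \<or> j < l"
      by blast
    have k: "i < Suc i" "Suc i < j"
      using * assms(4) by auto
    have "ps ! i \<noteq> ps ! j"
      using out[OF l(2,1)] by (auto simp: orientation_def)
    then obtain t where t: "\<And>r. c \<bullet> r = b - t * orientation (ps ! i) (ps ! j) r" "t \<noteq> 0"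
      using functional_proportional[of "ps ! i" "ps ! j" c] assms(2,6,7) by (metis scaleR_zero_left)
    have "0 \<le> t * orientation (ps ! i) (ps ! j) (ps ! l)"
      "0 \<le> t * orientation (ps ! i) (ps ! j) (ps ! Suc i)"
      using assms(3)[of "ps ! l"] assms(3)[of "ps ! Suc i"] t(1)[of "ps ! l"]
        t(1)[of "ps ! Suc i"] l(1) k assms(5) by auto
    then show False
      using out[OF l(2,1)] mid[OF k] t(2) by (auto simp: zero_le_mult_iff)
  qed
  then show ?thesis
  proof
    assume "j = Suc i"
    then show ?thesis
      using that[of i] two assms(5) by simp
  next
    assume "i = 0 \<and> Suc j = length ps"
    then show ?thesis
      using that[of j] two assms(5) by (auto simp: insert_commute)
  qed
qed

lemma ccw_polygon_maximal_face:
  assumes "ccw_polygon ps" "c \<noteq> 0" "\<And>p. p \<in> set ps \<Longrightarrow> c \<bullet> p \<le> b"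
    and "q \<in> convex hull (set ps)" "c \<bullet> q = b"
  obtains i where "i < length ps" "{x \<in> convex hull (set ps). c \<bullet> x = b} = {ps ! i}"
    | i where "i < length ps" "{x \<in> convex hull (set ps). c \<bullet> x = b} = segment ps i"
proof -
  have F: "{x \<in> convex hull (set ps). c \<bullet> x = b} = convex hull {p \<in> set ps. c \<bullet> p = b}"
    using assms(3) by (intro maximal_face_convex_hull) auto
  then have "{p \<in> set ps. c \<bullet> p = b} \<noteq> {}"
    using assms(4,5) by (metis (mono_tags, lifting) convex_hull_eq_empty empty_iff mem_Collect_eq)
  then obtain i where i: "i < length ps" "c \<bullet> (ps ! i) = b"
    by (auto simp: in_set_conv_nth)
  show ?thesis
  proof (cases "\<exists>j<length ps. j \<noteq> i \<and> c \<bullet> (ps ! j) = b")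
    case False
    then have "j = i" if "j < length ps" "c \<bullet> (ps ! j) = b" for j
      using that by blast
    then have "{p \<in> set ps. c \<bullet> p = b} = {ps ! i}"
      using i unfolding in_set_conv_nth by blast
    then show ?thesis
      using that(1)[OF i(1)] F by simp
  next
    case True
    then obtain j where j: "j < length ps" "j \<noteq> i" "c \<bullet> (ps ! j) = b"
      by blast
    then have "\<exists>l<length ps. {p \<in> set ps. c \<bullet> p = b} = {ps ! l, ps ! (Suc l mod length ps)}"
    proof (cases "i < j")
      case True
      show ?thesis
        by (rule ccw_polygon_maximal_vertices[OF assms(1-3) True j(1) i(2) j(3)]) blast+
    next
      case False
      then have "j < i"
        using j(2) by simp
      show ?thesis
        by (rule ccw_polygon_maximal_vertices[OF assms(1-3) \<open>j < i\<close> i(1) j(3) i(2)]) blast+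
    qed
    then obtain l where "l < length ps"
      "{p \<in> set ps. c \<bullet> p = b} = {ps ! l, ps ! (Suc l mod length ps)}"
      by blast
    then show ?thesis
      using that(2)[of l] F by (simp add: segment_def segment_convex_hull)
  qed
qed

section \<open>Supporting functionals and frontiers\<close>

lemma exists_supporting_functional:
  fixes S :: "'a::euclidean_space set"
  assumes "convex S" "interior S \<noteq> {}" "x \<in> S" "x \<in> frontier S"
  obtains c where "c \<noteq> 0" "\<And>y. y \<in> S \<Longrightarrow> c \<bullet> y \<le> c \<bullet> x"
proof -
  have "x \<notin> rel_interior S"
    using assms by (simp add: rel_interior_nonempty_interior frontier_def)
  then obtain a where "a \<noteq> 0" "\<And>y. y \<in> S \<Longrightarrow> a \<bullet> x \<le> a \<bullet> y"
    using supporting_hyperplane_rel_boundary[OF assms(1,3)] by metis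
  then show ?thesis
    using that[of "- a"] by simp
qed

lemma supporting_functional_frontier:
  fixes S :: "'a::euclidean_space set"
  assumes "c \<noteq> 0" "x \<in> S" "\<And>y. y \<in> S \<Longrightarrow> c \<bullet> y \<le> c \<bullet> x"
  shows "x \<in> frontier S"
proof -
  have "S \<subseteq> {y. c \<bullet> y \<le> c \<bullet> x}"
    using assms(3) by auto
  then have "interior S \<subseteq> {y. c \<bullet> y < c \<bullet> x}"
    using interior_mono interior_halfspace_le[OF assms(1)] by metis
  then show ?thesis
    using assms(2) closure_subset by (auto simp: frontier_def)
qed

lemma frontier_ccw_polygon:
  assumes "ccw_polygon ps"
  shows "frontier (convex hull (set ps)) \<subseteq> (\<Union>i<length ps. segment ps i)"
proof
  fix q assume q: "q \<in> frontier (convex hull (set ps))"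
  have cl: "closed (convex hull (set ps))"
    by (simp add: compact_imp_closed finite_imp_compact_convex_hull)
  then have mem: "q \<in> convex hull (set ps)"
    using q frontier_subset_closed by blast
  obtain c where c: "c \<noteq> 0" "\<And>y. y \<in> convex hull (set ps) \<Longrightarrow> c \<bullet> y \<le> c \<bullet> q"
    using exists_supporting_functional[OF convex_convex_hull interior_ccw_polygon[OF assms] mem q]
    by metis
  show "q \<in> (\<Union>i<length ps. segment ps i)"
  proof (rule ccw_polygon_maximal_face[OF assms c(1) c(2)[OF hull_inc] mem refl])
    fix i assume i: "i < length ps" "{x \<in> convex hull (set ps). c \<bullet> x = c \<bullet> q} = {ps ! i}"
    then have "q = ps ! i"
      using mem by blast
    then show ?thesis
      using i(1) by (auto simp: segment_def)
  next
    fix i assume "i < length ps" "{x \<in> convex hull (set ps). c \<bullet> x = c \<bullet> q} = segment ps i"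
    then show ?thesis
      using mem by blast
  qed
qed

section \<open>Adding the first quadrant\<close>

text \<open>Unlike in \<open>newton_polyhedron\<close> no hull is taken: the sum of a convex set and
  the quadrant is already convex.\<close>

definition quadrant_sum :: "(real \<times> real) set \<Rightarrow> (real \<times> real) set" where
  "quadrant_sum P = {p + q | p q. p \<in> P \<and> 0 \<le> fst q \<and> 0 \<le> snd q}"

lemma newton_polyhedron_eq: "newton_polyhedron X = quadrant_sum (newton_polytope X)"
proof -
  have eq: "quadrant_sum P = P + {0..} \<times> {0..}" for P
    unfolding quadrant_sum_def set_plus_def Bex_def mem_Times_iff atLeast_iff by blast
  have "convex hull ({0..} \<times> {0..}) = ({0..} \<times> {0..} :: (real \<times> real) set)"
    by (intro hull_same convex_Times) auto
  then have "convex hull quadrant_sum (real_point ` support X) = quadrant_sum (newton_polytope X)"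
    by (simp only: eq newton_polytope_def convex_hull_set_plus)
  then show ?thesis
    by (simp add: newton_polyhedron_def quadrant_sum_def)
qed

lemma convex_quadrant_sum:
  assumes "convex P"
  shows "convex (quadrant_sum P)"
proof -
  have "quadrant_sum P = (\<Union>x\<in>P. \<Union>y\<in>{0..} \<times> {0..}. {x + y})"
    unfolding quadrant_sum_def UNION_eq Bex_def mem_Times_iff atLeast_iff by blast
  moreover have "convex ({0..} \<times> {0..} :: (real \<times> real) set)"
    by (intro convex_Times) auto
  ultimately show ?thesis
    using convex_sums[OF assms] by simp
qed

lemma quadrant_sum_add:
  assumes "x \<in> quadrant_sum P" "0 \<le> fst q" "0 \<le> snd q"
  shows "x + q \<in> quadrant_sum P"
proof -
  obtain p r where "p \<in> P" "x = p + r" "0 \<le> fst r" "0 \<le> snd r"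
    using assms(1) by (auto simp: quadrant_sum_def)
  then show ?thesis
    unfolding quadrant_sum_def using assms(2,3)
    by (intro CollectI exI[of _ p] exI[of _ "r + q"]) (simp add: add.assoc)
qed

lemma subset_quadrant_sum: "P \<subseteq> quadrant_sum P"
  unfolding quadrant_sum_def by (force intro: exI[of _ 0])

text \<open>A functional that is maximal at \<open>x\<close> cannot grow along the unit vectors,
  because the sum contains the translates of \<open>x\<close> by them.\<close>

lemma quadrant_sum_functional_nonpos:
  assumes "x \<in> quadrant_sum P" "\<And>y. y \<in> quadrant_sum P \<Longrightarrow> c \<bullet> y \<le> c \<bullet> x"
  shows "fst c \<le> 0" "snd c \<le> 0"
  using assms(2)[OF quadrant_sum_add[OF assms(1), of "(1, 0)"]]
    assms(2)[OF quadrant_sum_add[OF assms(1), of "(0, 1)"]]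
  by (simp_all add: inner_prod_def algebra_simps)

lemma quadrant_sum_functional_le:
  assumes "fst c \<le> 0" "snd c \<le> 0" "\<And>p. p \<in> P \<Longrightarrow> c \<bullet> p \<le> b" "x \<in> quadrant_sum P"
  shows "c \<bullet> x \<le> b"
proof -
  obtain p q where x: "p \<in> P" "x = p + q" "0 \<le> fst q" "0 \<le> snd q"
    using assms(4) by (auto simp: quadrant_sum_def)
  have "c \<bullet> q \<le> 0"
    using x assms(1,2) by (simp add: inner_prod_def add_nonpos_nonpos mult_nonpos_nonneg)
  then show ?thesis
    using x assms(3)[of p] by (simp add: inner_add_right)
qed

text \<open>Adding a nonzero vector of the quadrant strictly lowers the functional, so the bound
  \<open>b\<close> can only be attained in \<open>P\<close> itself.\<close>

lemma quadrant_sum_maximal_face: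
  assumes "fst c < 0" "snd c < 0" "\<And>p. p \<in> P \<Longrightarrow> c \<bullet> p \<le> b"
  shows "{x \<in> quadrant_sum P. c \<bullet> x = b} = {x \<in> P. c \<bullet> x = b}"
proof -
  have "x \<in> P" if x: "x \<in> quadrant_sum P" "c \<bullet> x = b" for x
  proof -
    obtain p q where q: "p \<in> P" "x = p + q" "0 \<le> fst q" "0 \<le> snd q"
      using x(1) by (auto simp: quadrant_sum_def)
    have "fst c * fst q \<le> 0" "snd c * snd q \<le> 0"
      using q assms(1,2) by (simp_all add: mult_nonpos_nonneg)
    moreover have "fst c * fst q + snd c * snd q \<ge> 0"
      using assms(3)[OF q(1)] x(2) q(2) by (simp add: inner_prod_def algebra_simps)
    ultimately have "fst c * fst q = 0" "snd c * snd q = 0"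
      by linarith+
    then have "q = 0"
      using assms(1,2) by (simp add: prod_eq_iff)
    then show ?thesis
      using q by simp
  qed
  then show ?thesis
    using subset_quadrant_sum by blast
qed

section \<open>Normals of the edges in the two boundaries\<close>

lemma outer_normal_nonzero:
  assumes "ccw_polygon ps" "i < length ps"
  shows "outer_normal ps i \<noteq> 0"
  using ccw_polygon_edge_proper[OF assms] by (auto simp: outer_normal_def prod_eq_iff)

lemma outer_normal_face:
  assumes "ccw_polygon ps" "i < length ps"
  shows "{x \<in> convex hull (set ps). outer_normal ps i \<bullet> x = outer_normal ps i \<bullet> (ps ! i)} = segment ps i"
proof -
  let ?j = "Suc i mod length ps"
  have j: "?j < length ps"
    using assms(2) by (intro mod_less_divisor) auto
  have "k = i \<or> k = ?j" if "k < length ps" "outer_normal ps i \<bullet> (ps ! k) = outer_normal ps i \<bullet> (ps ! i)" for k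
    using ccw_polygon_edge[OF assms that(1)] that(2) inner_outer_normal[of ps i "ps ! k"] by force
  then have "{p \<in> set ps. outer_normal ps i \<bullet> p = outer_normal ps i \<bullet> (ps ! i)} \<subseteq> {ps ! i, ps ! ?j}"
    unfolding in_set_conv_nth by blast
  moreover have "outer_normal ps i \<bullet> (ps ! ?j) = outer_normal ps i \<bullet> (ps ! i)"
    by (simp add: outer_normal_def inner_prod_def algebra_simps)
  ultimately have "{p \<in> set ps. outer_normal ps i \<bullet> p = outer_normal ps i \<bullet> (ps ! i)} = {ps ! i, ps ! ?j}"
    using assms(2) nth_mem[OF j] by auto
  then show ?thesis
    using ccw_polygon_edge_le[OF assms]
    by (subst maximal_face_convex_hull) (simp_all add: hull_inc segment_def segment_convex_hull)
qed

lemma segment_subset_hull: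
  assumes "i < length ps"
  shows "segment ps i \<subseteq> convex hull (set ps)"
proof -
  have "Suc i mod length ps < length ps"
    using assms by (intro mod_less_divisor) auto
  then have "ps ! (Suc i mod length ps) \<in> set ps"
    by (rule nth_mem)
  then show ?thesis
    unfolding segment_def using assms
    by (intro closed_segment_subset) (simp_all add: hull_inc)
qed

lemma interior_quadrant_sum:
  assumes "ccw_polygon ps"
  shows "interior (quadrant_sum (convex hull (set ps))) \<noteq> {}"
  using interior_ccw_polygon[OF assms] interior_mono[OF subset_quadrant_sum] by blast

lemma outer_normal_nonpos_imp_frontier:
  assumes "ccw_polygon ps" "i < length ps" "fst (outer_normal ps i) \<le> 0" "snd (outer_normal ps i) \<le> 0"
  shows "segment ps i \<subseteq> frontier (quadrant_sum (convex hull (set ps)))"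
proof
  fix x assume x: "x \<in> segment ps i"
  then have "x \<in> convex hull (set ps)" and eq: "outer_normal ps i \<bullet> x = outer_normal ps i \<bullet> (ps ! i)"
    using outer_normal_face[OF assms(1,2)] by auto
  then have "x \<in> quadrant_sum (convex hull (set ps))"
    using subset_quadrant_sum by blast
  moreover have "outer_normal ps i \<bullet> y \<le> outer_normal ps i \<bullet> x"
    if "y \<in> quadrant_sum (convex hull (set ps))" for y
    unfolding eq using assms(3,4) ccw_polygon_edge_le[OF assms(1,2)] that
    by (rule quadrant_sum_functional_le)
  ultimately show "x \<in> frontier (quadrant_sum (convex hull (set ps)))"
    by (rule supporting_functional_frontier[OF outer_normal_nonzero[OF assms(1,2)]])
qed

text \<open>A functional supporting the sum at an inner point of the edge is constant along the
  edge, hence a positive multiple of the outer normal. But a functional with a maximum on the sum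
  has no positive coordinate.\<close>

lemma open_segment_notin_frontier:
  assumes "ccw_polygon ps" "i < length ps" "\<not> (fst (outer_normal ps i) \<le> 0 \<and> snd (outer_normal ps i) \<le> 0)"
    and "x \<in> open_segment (ps ! i) (ps ! (Suc i mod length ps))"
  shows "x \<notin> frontier (quadrant_sum (convex hull (set ps)))"
proof
  let ?Q = "quadrant_sum (convex hull (set ps))" and ?j = "Suc i mod length ps"
  assume fr: "x \<in> frontier ?Q"
  have sub: "segment ps i \<subseteq> ?Q"
    using segment_subset_hull[OF assms(2)] subset_quadrant_sum by blast
  have x: "x \<in> ?Q"
    using assms(4) sub open_closed_segment unfolding segment_def by blast
  obtain c where c: "c \<noteq> 0" "\<And>y. y \<in> ?Q \<Longrightarrow> c \<bullet> y \<le> c \<bullet> x"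
    using exists_supporting_functional[OF convex_quadrant_sum[OF convex_convex_hull]
        interior_quadrant_sum[OF assms(1)] x fr] by metis
  obtain u where u: "0 < u" "u < 1" "x = (1 - u) *\<^sub>R (ps ! i) + u *\<^sub>R (ps ! ?j)"
    using assms(4) by (auto simp: in_segment)
  have le: "c \<bullet> (ps ! i) \<le> c \<bullet> x" "c \<bullet> (ps ! ?j) \<le> c \<bullet> x"
    using sub by (auto intro!: c(2) simp: segment_def)
  have eq: "c \<bullet> x = (1 - u) * (c \<bullet> (ps ! i)) + u * (c \<bullet> (ps ! ?j))"
    using u(3) by (simp add: inner_add_right)
  have "(1 - u) * (c \<bullet> x - c \<bullet> (ps ! i)) + u * (c \<bullet> x - c \<bullet> (ps ! ?j)) = 0"
    using eq by (simp add: algebra_simps)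
  moreover have "(1 - u) * (c \<bullet> x - c \<bullet> (ps ! i)) \<ge> 0" "u * (c \<bullet> x - c \<bullet> (ps ! ?j)) \<ge> 0"
    using le u by simp_all
  ultimately have "(1 - u) * (c \<bullet> x - c \<bullet> (ps ! i)) = 0" "u * (c \<bullet> x - c \<bullet> (ps ! ?j)) = 0"
    by linarith+
  then have ceq: "c \<bullet> (ps ! i) = c \<bullet> x" "c \<bullet> (ps ! ?j) = c \<bullet> x"
    using u by simp_all
  have "c \<bullet> p \<le> c \<bullet> (ps ! i)" if "p \<in> set ps" for p
    unfolding ceq by (intro c(2) subsetD[OF subset_quadrant_sum] hull_inc that)
  then obtain t where t: "t > 0" "c = t *\<^sub>R outer_normal ps i"
    using outer_normal_maximal[OF assms(1,2) c(1)] ceq by metis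
  then show False
    using quadrant_sum_functional_nonpos[OF x c(2)] assms(3) by (auto simp: mult_le_0_iff)
qed

lemma segment_subset_upper_iff:
  assumes "ccw_polygon ps" "i < length ps"
  shows "segment ps i \<subseteq> closure (frontier (convex hull (set ps)) - frontier (quadrant_sum (convex hull (set ps))))
    \<longleftrightarrow> \<not> (fst (outer_normal ps i) \<le> 0 \<and> snd (outer_normal ps i) \<le> 0)" (is "_ \<subseteq> closure ?D \<longleftrightarrow> _")
proof
  let ?j = "Suc i mod length ps"
  assume "\<not> (fst (outer_normal ps i) \<le> 0 \<and> snd (outer_normal ps i) \<le> 0)"
  note nf = open_segment_notin_frontier[OF assms this]
  have "segment ps i \<subseteq> frontier (convex hull (set ps))"
  proof
    fix x assume "x \<in> segment ps i"
    then have x: "x \<in> convex hull (set ps)" "outer_normal ps i \<bullet> x = outer_normal ps i \<bullet> (ps ! i)"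
      using outer_normal_face[OF assms] by auto
    show "x \<in> frontier (convex hull (set ps))"
      using outer_normal_nonzero[OF assms] x(1)
      by (rule supporting_functional_frontier) (simp add: x(2) ccw_polygon_edge_le[OF assms])
  qed
  \<comment> \<open>The endpoints may lie on the frontier of the sum; the closure restores
    them.\<close>
  then have "open_segment (ps ! i) (ps ! ?j) \<subseteq> ?D"
    using nf open_closed_segment unfolding segment_def by blast
  then have "closure (open_segment (ps ! i) (ps ! ?j)) \<subseteq> closure ?D"
    by (rule closure_mono)
  then show "segment ps i \<subseteq> closure ?D"
    using ccw_polygon_edge_proper[OF assms] by (simp add: segment_def)
next
  let ?j = "Suc i mod length ps"
  assume sub: "segment ps i \<subseteq> closure ?D"
  define m where "m = midpoint (ps ! i) (ps ! ?j)"
  show "\<not> (fst (outer_normal ps i) \<le> 0 \<and> snd (outer_normal ps i) \<le> 0)"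
  proof
    assume "fst (outer_normal ps i) \<le> 0 \<and> snd (outer_normal ps i) \<le> 0"
    then have "segment ps i \<subseteq> frontier (quadrant_sum (convex hull (set ps)))"
      using outer_normal_nonpos_imp_frontier[OF assms] by blast
    \<comment> \<open>What remains of the frontier lies on the other edges, whose union is closed.
      So the closure could contain edge \<open>i\<close> only if its midpoint lay on some other edge
      \<open>k\<close>.\<close>
    then have "?D \<subseteq> (\<Union>k\<in>{..<length ps} - {i}. segment ps k)"
      using frontier_ccw_polygon[OF assms(1)] by blast
    moreover have "closed (\<Union>k\<in>{..<length ps} - {i}. segment ps k)"
      by (intro closed_UN) (auto simp: segment_def)
    ultimately have "closure ?D \<subseteq> (\<Union>k\<in>{..<length ps} - {i}. segment ps k)"
      by (rule closure_minimal)
    moreover have m: "m \<in> segment ps i"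
      by (simp add: m_def segment_def)
    ultimately obtain k where k: "k < length ps" "k \<noteq> i" "m \<in> segment ps k"
      using sub by blast
    let ?n = "outer_normal ps k" and ?l = "Suc k mod length ps"
    have "?n \<bullet> m = ?n \<bullet> (ps ! k)"
      using k outer_normal_face[OF assms(1) k(1)] by auto
    moreover have "?n \<bullet> m = (?n \<bullet> (ps ! i) + ?n \<bullet> (ps ! ?j)) / 2"
      by (simp add: m_def midpoint_def inner_add_right)
    moreover have j: "?j < length ps"
      using assms(2) by (intro mod_less_divisor) auto
    \<comment> \<open>Both endpoints lie weakly on the left of edge \<open>k\<close> and their
      midpoint on its line, so both lie on this line.\<close>
    ultimately have o: "orientation (ps ! k) (ps ! ?l) (ps ! i) + orientation (ps ! k) (ps ! ?l) (ps ! ?j) = 0"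
      using inner_outer_normal[of ps k "ps ! i"] inner_outer_normal[of ps k "ps ! ?j"] by (simp add: field_simps)
    have nn: "orientation (ps ! k) (ps ! ?l) (ps ! r) \<ge> 0" if "r < length ps" for r
      using ccw_polygon_edge_le[OF assms(1) k(1) hull_inc[OF nth_mem[OF that]]]
        inner_outer_normal[of ps k "ps ! r"] by linarith
    have z: "orientation (ps ! k) (ps ! ?l) (ps ! i) = 0" "orientation (ps ! k) (ps ! ?l) (ps ! ?j) = 0"
      using nn[OF assms(2)] nn[OF j] o by linarith+
    then have il: "i = ?l"
      using ccw_polygon_edge[OF assms(1) k(1) assms(2)] k(2) by force
    have "?j = k \<or> ?j = ?l"
      using z ccw_polygon_edge[OF assms(1) k(1) j] by force
    moreover have "?j \<noteq> i"
      using ccw_polygon_edge_proper[OF assms] by metis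
    ultimately have "?j = k"
      using il by simp
    \<comment> \<open>Two edges that succeed each other in both directions would close a cycle of
      length two.\<close>
    then have "k = Suc i mod length ps" "i = Suc k mod length ps"
      using il by simp_all
    moreover have "3 \<le> length ps"
      using assms(1) by (simp add: ccw_polygon_def)
    ultimately show False
      using assms(2) k(1) by (simp add: mod_Suc split: if_splits)
  qed
qed

lemma aff_dim_ccw_polygon_segment:
  assumes "ccw_polygon ps" "i < length ps"
  shows "aff_dim (segment ps i) = 1"
  using ccw_polygon_edge_proper[OF assms]
  by (simp add: segment_def segment_convex_hull aff_dim_convex_hull)

text \<open>If a coordinate of \<open>c\<close> vanished, the face would contain a ray parallel to
  an axis.\<close>

lemma compact_edge_functional_neg:
  assumes "F = {x \<in> quadrant_sum P. c \<bullet> x = c \<bullet> q}" "compact F" "q \<in> quadrant_sum P"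
    and "\<And>y. y \<in> quadrant_sum P \<Longrightarrow> c \<bullet> y \<le> c \<bullet> q"
  shows "fst c < 0" "snd c < 0"
proof -
  obtain B where B: "\<And>x. x \<in> F \<Longrightarrow> norm x \<le> B"
    using compact_imp_bounded[OF assms(2)] by (auto simp: bounded_iff)
  have "c \<bullet> e \<noteq> 0" if e: "0 \<le> fst e" "0 \<le> snd e" "norm e = 1" for e
  proof
    assume 0: "c \<bullet> e = 0"
    \<comment> \<open>Far enough along the ray to leave the ball of radius \<open>B\<close>.\<close>
    define t where "t = B + norm q + 1"
    have "q \<in> F"
      using assms(1,3) by simp
    then have t: "t > 0"
      using B[of q] norm_ge_zero[of q] unfolding t_def by linarith
    then have "q + t *\<^sub>R e \<in> F"
      unfolding assms(1) using 0 e by (auto intro!: quadrant_sum_add assms(3) simp: inner_add_right)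
    then have "norm (q + t *\<^sub>R e) \<le> B"
      by (rule B)
    moreover have "norm (t *\<^sub>R e) \<le> norm (q + t *\<^sub>R e) + norm q"
      using norm_triangle_ineq4[of "q + t *\<^sub>R e" q] by simp
    ultimately show False
      using t e(3) by (simp add: t_def)
  qed
  from this[of "(1, 0)"] this[of "(0, 1)"] show "fst c < 0" "snd c < 0"
    using quadrant_sum_functional_nonpos[OF assms(3,4)] by (simp_all add: inner_prod_def)
qed

lemma compact_edges_quadrant_sum:
  assumes "ccw_polygon ps"
  shows "{e. e edge_of quadrant_sum (convex hull (set ps)) \<and> compact e} =
    {segment ps i | i. i < length ps \<and> fst (outer_normal ps i) < 0 \<and> snd (outer_normal ps i) < 0}"
    (is "{e. e edge_of ?Q \<and> _} = _")
proof (intro subset_antisym subsetI)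
  fix e assume "e \<in> {segment ps i | i. i < length ps \<and> fst (outer_normal ps i) < 0 \<and> snd (outer_normal ps i) < 0}"
  then obtain i where i: "i < length ps" "fst (outer_normal ps i) < 0" "snd (outer_normal ps i) < 0"
    and e: "e = segment ps i"
    by blast
  let ?n = "outer_normal ps i"
  have "e = ?Q \<inter> {x. ?n \<bullet> x = ?n \<bullet> (ps ! i)}"
    using quadrant_sum_maximal_face[OF i(2,3) ccw_polygon_edge_le[OF assms i(1)]]
      outer_normal_face[OF assms i(1)] e by auto
  moreover have "?Q \<inter> {x. ?n \<bullet> x = ?n \<bullet> (ps ! i)} face_of ?Q"
    using i(2,3) quadrant_sum_functional_le[OF _ _ ccw_polygon_edge_le[OF assms i(1)]]
    by (intro face_of_Int_supporting_hyperplane_le convex_quadrant_sum convex_convex_hull) simp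
  ultimately have "e face_of ?Q"
    by simp
  moreover have "compact e"
    unfolding e segment_def by (rule compact_segment)
  ultimately show "e \<in> {e. e edge_of ?Q \<and> compact e}"
    using aff_dim_ccw_polygon_segment[OF assms i(1)] e by (simp add: edge_of_def)
next
  fix e assume "e \<in> {e. e edge_of ?Q \<and> compact e}"
  then have e: "e face_of ?Q" "aff_dim e = 1" "compact e"
    by (auto simp: edge_of_def)
  have Q: "aff_dim ?Q = 2"
    using interior_quadrant_sum[OF assms] aff_dim_nonempty_interior[of ?Q] by simp
  have "e \<noteq> {}"
    using e(2) by auto
  then obtain q where q: "q \<in> rel_interior e"
    using rel_interior_eq_empty[OF face_of_imp_convex[OF e(1)]] by blast
  then have qe: "q \<in> e"
    using rel_interior_subset by blast
  then have qQ: "q \<in> ?Q"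
    using face_of_imp_subset[OF e(1)] by blast
  have "e \<noteq> ?Q"
    using Q e(2) by auto
  then have "q \<in> frontier ?Q"
    using face_of_disjoint_interior[OF e(1)] qe qQ closure_subset by (auto simp: frontier_def)
  then obtain c where c: "c \<noteq> 0" "\<And>y. y \<in> ?Q \<Longrightarrow> c \<bullet> y \<le> c \<bullet> q"
    using exists_supporting_functional[OF convex_quadrant_sum[OF convex_convex_hull]
        interior_quadrant_sum[OF assms] qQ] by metis
  \<comment> \<open>Shows that the face \<open>e\<close> is exposed: \<open>F\<close> contains a
    relative interior point of \<open>e\<close>, hence all of \<open>e\<close>, and lies on a line,
    so equal dimensions give \<open>e = F\<close>.\<close>
  define F where "F = ?Q \<inter> {x. c \<bullet> x = c \<bullet> q}"
  have F: "F face_of ?Q"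
    unfolding F_def using c(2)
    by (intro face_of_Int_supporting_hyperplane_le convex_quadrant_sum convex_convex_hull) simp
  have "e \<subseteq> F"
    by (rule subset_of_face_of[OF F face_of_imp_subset[OF e(1)]]) (use q qQ F_def in auto)
  then have eF: "e face_of F"
    using face_of_subset[OF e(1)] F_def by simp
  have "aff_dim F \<le> aff_dim {x. c \<bullet> x = c \<bullet> q}"
    by (intro aff_dim_subset) (auto simp: F_def)
  then have "aff_dim F \<le> 1"
    using c(1) by simp
  then have "e = F"
    using face_of_aff_dim_lt[OF face_of_imp_convex[OF F] eF] e(2) by linarith
  then have eq: "e = {x \<in> ?Q. c \<bullet> x = c \<bullet> q}"
    by (auto simp: F_def)
  note neg = compact_edge_functional_neg[OF eq e(3) qQ c(2)]
  have le: "c \<bullet> p \<le> c \<bullet> q" if "p \<in> convex hull (set ps)" for p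
    using that c(2) subset_quadrant_sum by blast
  have eP: "e = {x \<in> convex hull (set ps). c \<bullet> x = c \<bullet> q}"
    unfolding eq using neg le by (rule quadrant_sum_maximal_face)
  then have qP: "q \<in> convex hull (set ps)"
    using qe by blast
  show "e \<in> {segment ps i | i. i < length ps \<and> fst (outer_normal ps i) < 0 \<and> snd (outer_normal ps i) < 0}"
  proof (rule ccw_polygon_maximal_face[OF assms c(1) le[OF hull_inc] qP refl])
    fix i assume "i < length ps" "{x \<in> convex hull (set ps). c \<bullet> x = c \<bullet> q} = {ps ! i}"
    then show ?thesis
      using eP e(2) by simp
  next
    fix i assume i: "i < length ps" "{x \<in> convex hull (set ps). c \<bullet> x = c \<bullet> q} = segment ps i"
    have "ps ! i \<in> segment ps i" "ps ! (Suc i mod length ps) \<in> segment ps i"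
      by (simp_all add: segment_def)
    then have "c \<bullet> (ps ! i) = c \<bullet> q" "c \<bullet> (ps ! (Suc i mod length ps)) = c \<bullet> q"
      unfolding i(2)[symmetric] by simp_all
    then obtain t where t: "t > 0" "c = t *\<^sub>R outer_normal ps i"
      using outer_normal_maximal[OF assms i(1) c(1)] le[OF hull_inc] by metis
    then have "fst (outer_normal ps i) < 0 \<and> snd (outer_normal ps i) < 0"
      using neg by (simp add: mult_less_0_iff)
    then show ?thesis
      using i eP by blast
  qed
qed


section \<open>Edges before and after the upper main vertex\<close>

text \<open>Let b lead from the first vertex to \<open>ps ! i\<close>, d along the edge, and e from
  \<open>ps ! i\<close> to the top vertex. In (d x e) b + (e x b) d + (b x d) e = 0 a rising edge
  would make all three cross products and all three second coordinates positive.\<close>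

lemma edge_after_top_descends:
  assumes "ccw_polygon ps" "h < i" "i < length ps"
    and lex: "\<And>j. j < length ps \<Longrightarrow> fst (ps ! 0) \<le> fst (ps ! j)"
      "\<And>j. j < length ps \<Longrightarrow> fst (ps ! j) = fst (ps ! 0) \<Longrightarrow> snd (ps ! 0) \<le> snd (ps ! j)"
    and top: "\<And>j. j < length ps \<Longrightarrow> snd (ps ! j) \<le> snd (ps ! Suc h)"
  shows "snd (ps ! (Suc i mod length ps)) \<le> snd (ps ! i)"
proof (rule ccontr)
  let ?j = "Suc i mod length ps"
  define ax ay bx "by" dx dy where
    "ax = fst (ps ! Suc h) - fst (ps ! 0)" and "ay = snd (ps ! Suc h) - snd (ps ! 0)" and
    "bx = fst (ps ! i) - fst (ps ! 0)" and "by = snd (ps ! i) - snd (ps ! 0)" and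
    "dx = fst (ps ! ?j) - fst (ps ! i)" and "dy = snd (ps ! ?j) - snd (ps ! i)"
  note defs = this
  have ccw: "orientation (ps ! i) (ps ! j) (ps ! k) > 0" if "i < j" "j < k" "k < length ps" for i j k
    using assms(1) that unfolding ccw_polygon_def by blast
  have j: "?j < length ps"
    using assms(3) by (intro mod_less_divisor) auto
  assume "\<not> ?thesis"
  then have dy: "dy > 0"
    by (simp add: dy_def)
  then have "i \<noteq> Suc h"
    using top[OF j] by (auto simp: dy_def)
  then have i: "Suc h < i"
    using assms(2) by simp
  have x: "ax \<ge> 0" "bx \<ge> 0"
    using lex(1)[of "Suc h"] lex(1)[of i] i assms(3) by (simp_all add: defs)
  have y: "ay \<ge> 0" "ay - by \<ge> dy"
    using top[OF le_less_trans[OF zero_le assms(3)]] top[OF j] by (simp_all add: defs)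
  have ab: "ax * by - ay * bx > 0"
    using ccw[of 0 "Suc h" i] i assms(3) by (simp add: orientation_def defs)
  \<comment> \<open>Otherwise \<open>ps ! i\<close>, which is not to the left of the first vertex,
    could not lie on the left of the ray from there to the top vertex.\<close>
  have b: "by > 0"
  proof (rule ccontr)
    assume "\<not> by > 0"
    then have "ax * by \<le> 0" "ay * bx \<ge> 0"
      using x y by (simp_all add: mult_nonneg_nonpos)
    then show False
      using ab by linarith
  qed
  show False
  proof (cases "Suc i < length ps")
    case True
    have bd: "bx * dy - by * dx > 0"
      using ccw[of 0 i "Suc i"] i True by (simp add: orientation_def defs algebra_simps)
    have ad: "(ay - by) * dx - (ax - bx) * dy > 0"
      using ccw[of "Suc h" i "Suc i"] i True by (simp add: orientation_def defs algebra_simps)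
    have "((ay - by) * dx - (ax - bx) * dy) * by + (ax * by - ay * bx) * dy
        + (bx * dy - by * dx) * (ay - by) = 0"
      by (simp add: algebra_simps)
    moreover have "((ay - by) * dx - (ax - bx) * dy) * by > 0" "(ax * by - ay * bx) * dy > 0"
      "(bx * dy - by * dx) * (ay - by) > 0"
      using ad b ab bd dy y(2) by simp_all
    ultimately show False
      by linarith
  next
    case False
    then have "Suc i = length ps"
      using assms(3) by simp
    then show False
      using dy b by (simp add: defs)
  qed
qed

text \<open>The same identity for b, d and the vector w to \<open>ps ! h\<close>, under the weight
  L. If L did not increase along d, then L(w) > 0 would force L(b) < 0. As d runs to the left and b
  does not, \<beta> (b x d) = bx L(d) - dx L(b) would then be negative.\<close>

lemma edge_before_main_ascends:
  fixes \<alpha> \<beta> :: real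
  assumes "ccw_polygon ps" "0 < i" "i < h" "h < length ps" "\<beta> > 0"
    and lex: "fst (ps ! 0) \<le> fst (ps ! i)"
    and "fst (ps ! Suc i) < fst (ps ! i)"
    and main: "\<alpha> * fst (ps ! i) + \<beta> * snd (ps ! i) < \<alpha> * fst (ps ! h) + \<beta> * snd (ps ! h)"
  shows "\<alpha> * fst (ps ! i) + \<beta> * snd (ps ! i) < \<alpha> * fst (ps ! Suc i) + \<beta> * snd (ps ! Suc i)"
proof (rule ccontr)
  define bx "by" dx dy wx wy where
    "bx = fst (ps ! i) - fst (ps ! 0)" and "by = snd (ps ! i) - snd (ps ! 0)" and
    "dx = fst (ps ! Suc i) - fst (ps ! i)" and "dy = snd (ps ! Suc i) - snd (ps ! i)" and
    "wx = fst (ps ! h) - fst (ps ! i)" and "wy = snd (ps ! h) - snd (ps ! i)"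
  note defs = this
  have ccw: "orientation (ps ! i) (ps ! j) (ps ! k) > 0" if "i < j" "j < k" "k < length ps" for i j k
    using assms(1) that unfolding ccw_polygon_def by blast
  assume "\<not> ?thesis"
  then have Ld: "\<alpha> * dx + \<beta> * dy \<le> 0"
    by (simp add: defs algebra_simps)
  moreover have Lw: "\<alpha> * wx + \<beta> * wy > 0"
    using main by (simp add: defs algebra_simps)
  ultimately have "Suc i \<noteq> h"
    by (auto simp: defs)
  then have i: "Suc i < h"
    using assms(3) by simp
  have bd: "bx * dy - by * dx > 0"
    using ccw[of 0 i "Suc i"] assms(2) i assms(4) by (simp add: orientation_def defs algebra_simps)
  have dw: "dx * wy - dy * wx > 0"
    using ccw[of i "Suc i" h] i assms(4) by (simp add: orientation_def defs algebra_simps)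
  have bw: "bx * wy - by * wx > 0"
    using ccw[of 0 i h] assms(2) i assms(4) by (simp add: orientation_def defs algebra_simps)
  have "(bx * dy - by * dx) * (\<alpha> * wx + \<beta> * wy) =
      - (dx * wy - dy * wx) * (\<alpha> * bx + \<beta> * by) + (bx * wy - by * wx) * (\<alpha> * dx + \<beta> * dy)"
    by (simp add: algebra_simps)
  moreover have "(bx * dy - by * dx) * (\<alpha> * wx + \<beta> * wy) > 0"
    using bd Lw by simp
  moreover have "(bx * wy - by * wx) * (\<alpha> * dx + \<beta> * dy) \<le> 0"
    using bw Ld by (simp add: mult_le_0_iff)
  ultimately have "(dx * wy - dy * wx) * (\<alpha> * bx + \<beta> * by) < 0"
    by linarith
  then have Lb: "\<alpha> * bx + \<beta> * by < 0"
    using dw by (simp add: mult_less_0_iff)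
  have "\<beta> * (bx * dy - by * dx) = bx * (\<alpha> * dx + \<beta> * dy) - dx * (\<alpha> * bx + \<beta> * by)"
    by (simp add: algebra_simps)
  moreover have "\<beta> * (bx * dy - by * dx) > 0"
    using bd assms(5) by simp
  moreover have "bx * (\<alpha> * dx + \<beta> * dy) \<le> 0"
    using lex Ld by (simp add: defs mult_nonneg_nonpos)
  moreover have "dx * (\<alpha> * bx + \<beta> * by) > 0"
    using Lb assms(7) by (simp add: dx_def mult_neg_neg)
  ultimately show False
    by linarith
qed

locale main_segment_polygon =
  fixes ps :: "(real \<times> real) list" and h :: nat and \<alpha> \<beta> :: real
  assumes ccw: "ccw_polygon ps" and h: "h < length ps" and pos: "\<alpha> > 0" "\<beta> > 0"
    and lex: "\<And>p. p \<in> set ps \<Longrightarrow> lex_le (ps ! 0) p"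
    and top: "\<And>p. p \<in> set ps \<Longrightarrow> snd p \<le> snd (ps ! (Suc h mod length ps))"
    and main: "\<alpha> * fst (ps ! (Suc h mod length ps)) + \<beta> * snd (ps ! (Suc h mod length ps)) =
      \<alpha> * fst (ps ! h) + \<beta> * snd (ps ! h)"
begin

text \<open>The main edge does not descend, so it is directed along (-\<beta>, \<alpha>), and the
  vertices on its left have smaller weight.\<close>

lemma weight_less:
  assumes "j < length ps" "j \<noteq> h" "j \<noteq> Suc h mod length ps"
  shows "\<alpha> * fst (ps ! j) + \<beta> * snd (ps ! j) < \<alpha> * fst (ps ! h) + \<beta> * snd (ps ! h)"
proof -
  let ?T = "ps ! (Suc h mod length ps)"
  let ?o = "orientation (ps ! h) ?T (ps ! j)"
  let ?dy = "snd ?T - snd (ps ! h)"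
  have "\<alpha> * (fst ?T - fst (ps ! h)) = - \<beta> * ?dy"
    using main by (simp add: algebra_simps)
  then have eq: "\<alpha> * ?o = ?dy * (\<alpha> * fst (ps ! h) + \<beta> * snd (ps ! h) - (\<alpha> * fst (ps ! j) + \<beta> * snd (ps ! j)))"
    unfolding orientation_def by algebra
  have "?dy \<ge> 0"
    using top[OF nth_mem[OF h]] by simp
  moreover have "\<alpha> * ?o > 0"
    using ccw_polygon_edge[OF ccw h assms] pos by simp
  ultimately show ?thesis
    unfolding eq by (simp add: zero_less_mult_iff)
qed

text \<open>This is what keeps the exponents of v in the compactification nonnegative.\<close>

lemma weight_le:
  assumes "p \<in> set ps"
  shows "\<alpha> * fst p + \<beta> * snd p \<le> \<alpha> * fst (ps ! h) + \<beta> * snd (ps ! h)"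
proof -
  obtain j where "j < length ps" "p = ps ! j"
    using assms by (auto simp: in_set_conv_nth)
  then show ?thesis
    using weight_less[of j] main by (cases "j = h \<or> j = Suc h mod length ps") auto
qed

text \<open>The right-hand side says that the transformed normal, computed in
  \<open>outer_normal_exponent_map\<close>, has two negative coordinates.\<close>

lemma before_main_segment_iff:
  assumes "i < length ps"
  shows "i < h \<and> \<not> (fst (outer_normal ps i) \<le> 0 \<and> snd (outer_normal ps i) \<le> 0) \<longleftrightarrow>
    0 < fst (outer_normal ps i) \<and> 0 < \<beta> * fst (outer_normal ps i) - \<alpha> * snd (outer_normal ps i)"
    (is "?L \<longleftrightarrow> ?R")
proof
  assume L: ?L
  then have i: "Suc i < length ps"
    using h by simp
  then have n: "outer_normal ps i = (snd (ps ! Suc i) - snd (ps ! i), fst (ps ! i) - fst (ps ! Suc i))"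
    by (simp add: outer_normal_def)
  show ?R
  proof (cases "snd (outer_normal ps i) \<le> 0")
    \<comment> \<open>The normal is in the lower half-plane but not in the closed third quadrant,
      which settles both signs.\<close>
    case True
    then have "0 < fst (outer_normal ps i)"
      using L by auto
    moreover have "\<alpha> * snd (outer_normal ps i) \<le> 0"
      using True pos by (simp add: mult_le_0_iff)
    moreover have "0 < \<beta> * fst (outer_normal ps i)"
      using calculation pos by simp
    ultimately show ?thesis
      by linarith
  next
    case False
    then have left: "fst (ps ! Suc i) < fst (ps ! i)"
      by (simp add: n)
    have le: "fst (ps ! 0) \<le> fst (ps ! k)" if "k < length ps" for k
      using lex[OF nth_mem[OF that]] by (auto simp: lex_le_def)
    have "i \<noteq> 0"
      using le[OF i] left by (cases i) auto
    \<comment> \<open>The main segment ends at index 0 if it is the closing edge, and at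
      \<open>Suc h\<close> otherwise.\<close>
    moreover have "i \<noteq> Suc h mod length ps"
      using calculation L h by (cases "Suc h = length ps") auto
    moreover have "0 < i"
      using \<open>i \<noteq> 0\<close> by simp
    ultimately have "\<alpha> * fst (ps ! i) + \<beta> * snd (ps ! i) < \<alpha> * fst (ps ! Suc i) + \<beta> * snd (ps ! Suc i)"
      using L h pos le[of i] left assms weight_less[of i]
      by (intro edge_before_main_ascends[OF ccw, of _ h]) auto
    then have R: "0 < \<beta> * fst (outer_normal ps i) - \<alpha> * snd (outer_normal ps i)"
      by (simp add: n algebra_simps)
    moreover have "\<alpha> * snd (outer_normal ps i) > 0"
      using False pos by simp
    ultimately have "\<beta> * fst (outer_normal ps i) > 0"
      by linarith
    then show ?thesis
      using R pos by (simp add: zero_less_mult_iff)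
  qed
next
  assume R: ?R
  have "i \<noteq> h"
    using R main by (auto simp: outer_normal_def algebra_simps)
  moreover have "\<not> h < i"
  proof
    assume hi: "h < i"
    have "Suc h mod length ps = Suc h"
      using hi assms by simp
    then have "snd (ps ! (Suc i mod length ps)) \<le> snd (ps ! i)"
      using lex[OF nth_mem] top[OF nth_mem] assms
      by (intro edge_after_top_descends[OF ccw hi]) (force simp: lex_le_def)+
    then show False
      using R by (simp add: outer_normal_def)
  qed
  ultimately show ?L
    using R by simp
qed

end


section \<open>The support of the compactification\<close>

text \<open>The hypothesis prevents \<open>nat\<close> from truncating a negative exponent to 0,
  which would move \<open>a\<close> to another monomial.\<close>

lemma coeff_a_monomial_field:
  assumes "a = 0 \<or> -1 \<le> m \<and> 0 \<le> n"
  shows "coeff_a (monomial_field m n a b) i j = (if (i, j) = (m, n) then a else 0)"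
  using assms by (auto simp: coeff_a_def monomial_field_def)

lemma coeff_b_monomial_field:
  assumes "b = 0 \<or> 0 \<le> m \<and> -1 \<le> n"
  shows "coeff_b (monomial_field m n a b) i j = (if (i, j) = (m, n) then b else 0)"
  using assms by (auto simp: coeff_b_def monomial_field_def)

lemma coeff_a_sum: "coeff_a (sum f A) i j = (\<Sum>p\<in>A. coeff_a (f p) i j)"
  by (simp add: coeff_a_def fst_sum coeff_sum)

lemma coeff_b_sum: "coeff_b (sum f A) i j = (\<Sum>p\<in>A. coeff_b (f p) i j)"
  by (simp add: coeff_b_def snd_sum coeff_sum)

lemma in_support_iff: "(m, n) \<in> support X \<longleftrightarrow> coeff_a X m n \<noteq> 0 \<or> coeff_b X m n \<noteq> 0"
  by (simp add: support_def)

text \<open>Nothing cancels: the map of exponents is injective, and so is the map of coefficients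
  (a, b) to (b - (\<beta>/\<alpha>) a, -a/\<alpha>).\<close>

lemma support_compactification_x:
  assumes "\<alpha> > 0" "\<And>m n. (m, n) \<in> support X \<Longrightarrow> \<alpha> * m + \<beta> * n \<le> \<delta>"
  shows "support (compactification_x \<alpha> \<beta> \<delta> X) =
    (\<lambda>(m, n). (n, \<delta> - (\<alpha> * m + \<beta> * n))) ` support X"
proof -
  let ?g = "\<lambda>p::int \<times> int. (snd p, \<delta> - (\<alpha> * fst p + \<beta> * snd p))"
  let ?A = "\<lambda>p. coeff_b X (fst p) (snd p) - of_int \<beta> / of_int \<alpha> * coeff_a X (fst p) (snd p)"
  let ?B = "\<lambda>p. - (1 / of_int \<alpha>) * coeff_a X (fst p) (snd p)"
  let ?C = "compactification_x \<alpha> \<beta> \<delta> X"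
  have inj: "(fst (?g p), snd (?g p)) = ?g q \<longleftrightarrow> p = q" for p q
    using assms(1) by (auto simp: prod_eq_iff)
  have C: "?C = (\<Sum>p\<in>support X. monomial_field (fst (?g p)) (snd (?g p)) (?A p) (?B p))"
    by (simp add: compactification_x_def case_prod_unfold)
  have e: "0 \<le> snd (?g p)" if "p \<in> support X" for p
    using assms(2)[of "fst p" "snd p"] that by simp
  \<comment> \<open>\<open>n\<close> is for the first component, with exponent n + 1 of u;
    \<open>n'\<close> is for the second, with exponent n, whose coefficient is a multiple of
    a.\<close>
  have n: "-1 \<le> snd p" if "p \<in> support X" for p
    using that in_support_iff[of "fst p" "snd p" X] by (auto simp: coeff_a_def coeff_b_def split: if_splits)
  have n': "0 \<le> snd p" if "coeff_a X (fst p) (snd p) \<noteq> 0" for p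
    using that by (auto simp: coeff_a_def split: if_splits)
  have a: "coeff_a ?C i j = (\<Sum>p\<in>support X. if (i, j) = ?g p then ?A p else 0)" for i j
    unfolding C coeff_a_sum
  proof (rule sum.cong[OF refl])
    fix p assume "p \<in> support X"
    then show "coeff_a (monomial_field (fst (?g p)) (snd (?g p)) (?A p) (?B p)) i j =
        (if (i, j) = ?g p then ?A p else 0)"
      using e[of p] n[of p] by (subst coeff_a_monomial_field) auto
  qed
  have b: "coeff_b ?C i j = (\<Sum>p\<in>support X. if (i, j) = ?g p then ?B p else 0)" for i j
    unfolding C coeff_b_sum
  proof (rule sum.cong[OF refl])
    fix p assume "p \<in> support X"
    then show "coeff_b (monomial_field (fst (?g p)) (snd (?g p)) (?A p) (?B p)) i j =
        (if (i, j) = ?g p then ?B p else 0)"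
      using e[of p] n'[of p] by (subst coeff_b_monomial_field) auto
  qed
  have "?g p \<in> support ?C" if p: "p \<in> support X" for p
  proof -
    have "coeff_a ?C (fst (?g p)) (snd (?g p)) = (\<Sum>q\<in>support X. if p = q then ?A q else 0)"
      by (simp only: a inj)
    then have A: "coeff_a ?C (fst (?g p)) (snd (?g p)) = ?A p"
      using p finite_support by simp
    have "coeff_b ?C (fst (?g p)) (snd (?g p)) = (\<Sum>q\<in>support X. if p = q then ?B q else 0)"
      by (simp only: b inj)
    then have B: "coeff_b ?C (fst (?g p)) (snd (?g p)) = ?B p"
      using p finite_support by simp
    have "?A p \<noteq> 0 \<or> ?B p \<noteq> 0"
      using p in_support_iff[of "fst p" "snd p" X] assms(1) by auto
    then show ?thesis
      using A B in_support_iff[of "fst (?g p)" "snd (?g p)"] by (metis prod.collapse)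
  qed
  moreover have "(i, j) \<in> ?g ` support X" if "(i, j) \<in> support ?C" for i j
  proof (rule ccontr)
    assume "(i, j) \<notin> ?g ` support X"
    then have "(i, j) \<noteq> ?g p" if "p \<in> support X" for p
      using that by blast
    then have "coeff_a ?C i j = 0" "coeff_b ?C i j = 0"
      unfolding a b by (simp_all del: prod.inject cong: sum.cong)
    then show False
      using that in_support_iff by blast
  qed
  ultimately have "support ?C = ?g ` support X"
    by (intro subset_antisym subsetI) auto
  then show ?thesis
    by (simp add: case_prod_unfold)
qed


section \<open>The map of exponents\<close>

lemma exponent_map_eq:
  "exponent_map \<alpha> \<beta> \<delta> p = (snd p, of_int \<delta> - of_int \<alpha> * fst p - of_int \<beta> * snd p)"
  by (simp add: exponent_map_def case_prod_unfold)

lemma exponent_map_affine: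
  obtains f where "linear f" "\<And>S. exponent_map \<alpha> \<beta> \<delta> ` S = (\<lambda>x. (0, of_int \<delta>) + x) ` f ` S"
proof
  let ?f = "\<lambda>p::real \<times> real. (snd p, - of_int \<alpha> * fst p - of_int \<beta> * snd p)"
  show "linear ?f"
    by (rule linearI) (simp_all add: algebra_simps)
  show "exponent_map \<alpha> \<beta> \<delta> ` S = (\<lambda>x. (0, of_int \<delta>) + x) ` ?f ` S" for S
    unfolding image_image by (intro image_cong refl) (simp add: exponent_map_eq)
qed

lemma convex_hull_exponent_map:
  "convex hull (exponent_map \<alpha> \<beta> \<delta> ` S) = exponent_map \<alpha> \<beta> \<delta> ` (convex hull S)"
proof -
  obtain f where "linear f" "\<And>S. exponent_map \<alpha> \<beta> \<delta> ` S = (\<lambda>x. (0, of_int \<delta>) + x) ` f ` S"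
    using exponent_map_affine by metis
  then show ?thesis
    by (simp only: convex_hull_translation convex_hull_linear_image)
qed

lemma segment_exponent_map:
  assumes "i < length ps"
  shows "segment (map (exponent_map \<alpha> \<beta> \<delta>) ps) i = exponent_map \<alpha> \<beta> \<delta> ` segment ps i"
proof -
  have "Suc i mod length ps < length ps"
    using assms by (intro mod_less_divisor) auto
  then show ?thesis
    using assms
    by (simp add: segment_def segment_convex_hull flip: convex_hull_exponent_map)
qed

lemma ccw_polygon_exponent_map:
  assumes "ccw_polygon ps" "\<alpha> > 0"
  shows "ccw_polygon (map (exponent_map \<alpha> \<beta> \<delta>) ps)"
proof -
  \<comment> \<open>The factor is the determinant of the linear part.\<close>
  have "orientation (exponent_map \<alpha> \<beta> \<delta> p) (exponent_map \<alpha> \<beta> \<delta> q) (exponent_map \<alpha> \<beta> \<delta> r)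
      = of_int \<alpha> * orientation p q r" for p q r
    by (simp add: orientation_def exponent_map_eq algebra_simps)
  then show ?thesis
    using assms by (auto simp: ccw_polygon_def)
qed

lemma outer_normal_exponent_map:
  assumes "i < length ps"
  shows "outer_normal (map (exponent_map \<alpha> \<beta> \<delta>) ps) i =
    (of_int \<alpha> * snd (outer_normal ps i) - of_int \<beta> * fst (outer_normal ps i), - fst (outer_normal ps i))"
proof -
  have "Suc i mod length ps < length ps"
    using assms by (intro mod_less_divisor) auto
  then show ?thesis
    using assms by (simp add: outer_normal_def exponent_map_eq algebra_simps)
qed

section \<open>Newton polytopes and their vertices\<close>

lemma newton_polytope_compactification_x:
  assumes "\<alpha> > 0"
    and "\<And>p. p \<in> newton_polytope X \<Longrightarrow> of_int \<alpha> * fst p + of_int \<beta> * snd p \<le> (of_int \<delta> :: real)"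
  shows "newton_polytope (compactification_x \<alpha> \<beta> \<delta> X) = exponent_map \<alpha> \<beta> \<delta> ` newton_polytope X"
proof -
  have le: "\<alpha> * m + \<beta> * n \<le> \<delta>" if "(m, n) \<in> support X" for m n
  proof -
    have "real_point (m, n) \<in> newton_polytope X"
      unfolding newton_polytope_def using that by (intro hull_inc imageI)
    then have "real_of_int \<alpha> * of_int m + of_int \<beta> * of_int n \<le> of_int \<delta>"
      using assms(2)[of "real_point (m, n)"] by (simp add: real_point_def)
    then have "real_of_int (\<alpha> * m + \<beta> * n) \<le> real_of_int \<delta>"
      by simp
    then show ?thesis
      by (simp only: of_int_le_iff)
  qed
  have "support (compactification_x \<alpha> \<beta> \<delta> X) = (\<lambda>(m, n). (n, \<delta> - (\<alpha> * m + \<beta> * n))) ` support X"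
    using assms(1) le by (rule support_compactification_x)
  then have "real_point ` support (compactification_x \<alpha> \<beta> \<delta> X) = exponent_map \<alpha> \<beta> \<delta> ` real_point ` support X"
    by (simp add: image_image real_point_def exponent_map_eq case_prod_unfold algebra_simps)
  then show ?thesis
    by (simp add: newton_polytope_def convex_hull_exponent_map)
qed

lemma newton_polytope_vertices:
  assumes "vertex_enumeration X ps"
  shows "newton_polytope X = convex hull (set ps)"
proof -
  have "compact (newton_polytope X)"
    by (simp add: newton_polytope_def finite_support finite_imp_compact_convex_hull)
  then show ?thesis
    using Krein_Milman_Minkowski[of "newton_polytope X"] assms
    by (simp add: vertex_enumeration_def newton_polytope_def)
qed

lemma vertices_in_support:
  assumes "vertex_enumeration X ps" "p \<in> set ps"
  shows "p \<in> real_point ` support X"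
  using assms extreme_point_of_convex_hull by (auto simp: vertex_enumeration_def newton_polytope_def)

text \<open>Favorability supplies an edge, so the polytope has dimension at least one; this excludes
  the empty set and single points.\<close>

lemma favorable_length_vertices:
  assumes "favorable X" "vertex_enumeration X ps"
  shows "2 \<le> length ps"
proof -
  obtain e where "e edge_of newton_polytope X"
    using assms(1) by (auto simp: favorable_def)
  then have "1 \<le> aff_dim (convex hull (set ps))"
    unfolding newton_polytope_vertices[OF assms(2)]
    by (metis edge_of_def edge_of_imp_subset aff_dim_subset)
  then have "1 \<le> int (card (set ps)) - 1"
    using aff_dim_le_card[of "set ps"] by (simp add: aff_dim_convex_hull)
  then show ?thesis
    using card_length[of ps] by linarith
qed

theorem proposition14:
  fixes X :: vector_field and \<alpha> \<beta> \<delta> :: int and ps :: "(real \<times> real) list" and h :: nat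
  assumes "favorable X"
    and "vertex_enumeration X ps"
    and "upper_main_segment X ps h"
    and "\<alpha> > 0" and "\<beta> > 0"
    and "segment ps h \<subseteq> {(m, n). of_int \<alpha> * m + of_int \<beta> * n = of_int \<delta>}"
  shows "lower_boundary (compactification_x \<alpha> \<beta> \<delta> X) =
         exponent_map \<alpha> \<beta> \<delta> ` right_upper_part X ps h"
proof -
  let ?E = "exponent_map \<alpha> \<beta> \<delta>" and ?C = "compactification_x \<alpha> \<beta> \<delta> X"
  let ?T = "ps ! (Suc h mod length ps)"
  let ?w = "\<lambda>p::real \<times> real. of_int \<alpha> * fst p + of_int \<beta> * snd p"
  note P = newton_polytope_vertices[OF assms(2)]
  have h: "h < length ps"
    using assms(3) by (simp add: upper_main_segment_def)
  have distinct: "distinct ps"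
    using assms(2) by (simp add: vertex_enumeration_def)
  have lex: "lex_le (ps ! 0) p" if "p \<in> set ps" for p
    using assms(2) vertices_in_support[OF assms(2) that] that by (auto simp: vertex_enumeration_def)
  have top: "snd p \<le> snd ?T" if "p \<in> set ps" for p
    using assms(3) that hull_inc[of p "set ps" convex]
    by (auto simp: upper_main_segment_def upper_main_vertex_def Let_def P)
  have "ps ! h \<in> segment ps h" "?T \<in> segment ps h"
    by (simp_all add: segment_def)
  then have line: "?w (ps ! h) = of_int \<delta>" "?w ?T = of_int \<delta>"
    using assms(6) by auto
  have polytope: "newton_polytope ?C = ?E ` newton_polytope X"
    if w: "\<And>p. p \<in> set ps \<Longrightarrow> ?w p \<le> of_int \<delta>"
  proof (rule newton_polytope_compactification_x[OF assms(4)])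
    have "convex {p. ?w p \<le> of_int \<delta>}"
      using convex_halfspace_le[of "(real_of_int \<alpha>, real_of_int \<beta>)" "of_int \<delta>"]
      by (simp add: inner_prod_def)
    then have "convex hull (set ps) \<subseteq> {p. ?w p \<le> of_int \<delta>}"
      using w by (intro hull_minimal) auto
    then show "?w p \<le> of_int \<delta>" if "p \<in> newton_polytope X" for p
      using that P by auto
  qed
  show ?thesis
  \<comment> \<open>The split matches the case distinction on the interior in the definitions of the
    boundaries.\<close>
  proof (cases "3 \<le> length ps")
    case True
    then have ccw: "ccw_polygon ps"
      using assms(2) by (auto simp: ccw_polygon_def vertex_enumeration_def)
    interpret main_segment_polygon ps h "of_int \<alpha>" "of_int \<beta>"
      using ccw h assms(4,5) lex top line by unfold_locales simp_all
    define qs where "qs = map ?E ps"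
    have qs: "ccw_polygon qs" "length qs = length ps"
      using ccw_polygon_exponent_map[OF ccw assms(4)] by (simp_all add: qs_def)
    have Q: "newton_polytope ?C = convex hull (set qs)"
      using polytope weight_le line(1) P by (simp add: qs_def convex_hull_exponent_map)
    have "lower_boundary ?C =
        \<Union> {segment qs i | i. i < length qs \<and> fst (outer_normal qs i) < 0 \<and> snd (outer_normal qs i) < 0}"
      unfolding lower_boundary_def newton_polyhedron_eq Q
      by (simp add: interior_ccw_polygon[OF qs(1)] compact_edges_quadrant_sum[OF qs(1)])
    also have "\<dots> = \<Union> {?E ` segment ps i | i. i < h \<and> segment ps i \<subseteq> upper_boundary X}"
    proof -
      have "i < length ps \<and> fst (outer_normal qs i) < 0 \<and> snd (outer_normal qs i) < 0 \<longleftrightarrow>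
          i < h \<and> segment ps i \<subseteq> upper_boundary X" for i
      proof (cases "i < length ps")
        case i: True
        have "segment ps i \<subseteq> upper_boundary X \<longleftrightarrow>
            \<not> (fst (outer_normal ps i) \<le> 0 \<and> snd (outer_normal ps i) \<le> 0)"
          unfolding upper_boundary_def newton_polyhedron_eq P
          using interior_ccw_polygon[OF ccw] segment_subset_upper_iff[OF ccw i] by simp
        then show ?thesis
          using before_main_segment_iff[OF i] outer_normal_exponent_map[OF i, of \<alpha> \<beta> \<delta>] i
          by (auto simp: qs_def)
      qed (use h in auto)
      moreover have "segment qs i = ?E ` segment ps i" if "i < length ps" for i
        using segment_exponent_map[OF that] by (simp add: qs_def)
      ultimately show ?thesis
        using qs(2) by (intro arg_cong[of _ _ Union] Collect_cong) metis
    qed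
    also have "\<dots> = ?E ` right_upper_part X ps h"
      unfolding right_upper_part_def by blast
    finally show ?thesis .
  next
    case False
    then have "length ps = 2"
      using favorable_length_vertices[OF assms(1,2)] by simp
    then obtain p q where ps: "ps = [p, q]"
      by (auto simp: length_Suc_conv numeral_2_eq_2)
    have "?w p = of_int \<delta>" "?w q = of_int \<delta>"
      using line h by (auto simp: ps less_Suc_eq)
    \<comment> \<open>Leaving the first vertex towards the top one leads weakly right and weakly up,
      but a level line of a positive weight descends. So the main segment is the way back.\<close>
    have "h \<noteq> 0"
    proof
      assume "h = 0"
      then have "snd p \<le> snd q" "fst p \<le> fst q"
        using top[of p] lex[of q] by (auto simp: ps lex_le_def)
      moreover have "of_int \<alpha> * (fst q - fst p) + of_int \<beta> * (snd q - snd p) = 0"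
        using \<open>?w p = _\<close> \<open>?w q = _\<close> by (simp add: algebra_simps)
      moreover have "of_int \<alpha> * (fst q - fst p) \<ge> 0" "of_int \<beta> * (snd q - snd p) \<ge> 0"
        using calculation assms(4,5) by simp_all
      ultimately have "of_int \<alpha> * (fst q - fst p) = 0" "of_int \<beta> * (snd q - snd p) = 0"
        by linarith+
      then have "p = q"
        using assms(4,5) by (simp add: prod_eq_iff)
      then show False
        using distinct ps by simp
    qed
    then have h1: "h = 1"
      using h by (simp add: ps)
    have seg: "newton_polytope X = segment ps 0"
      by (simp add: P ps segment_def segment_convex_hull)
    have "interior (newton_polytope X) = {}"
      by (simp add: seg segment_def interior_closed_segment_ge2)
    \<comment> \<open>Edge 0 precedes the main segment and is the same set, namely the whole
      polytope.\<close>
    then have "right_upper_part X ps h = newton_polytope X"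
      by (auto simp: right_upper_part_def h1 seg upper_boundary_def)
    moreover have C: "newton_polytope ?C = ?E ` newton_polytope X"
      using \<open>?w p = _\<close> \<open>?w q = _\<close> by (intro polytope) (auto simp: ps)
    moreover have "newton_polytope ?C = closed_segment (?E p) (?E q)"
      using segment_exponent_map[of 0 ps \<alpha> \<beta> \<delta>] C seg by (simp add: ps segment_def)
    then have "interior (newton_polytope ?C) = {}"
      by (simp add: interior_closed_segment_ge2)
    ultimately show ?thesis
      by (simp add: lower_boundary_def)
  qed
qed

end
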